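(* Let $n\geq 3$ and let $X\subset\mathbb{R}^n\setminus\{0\}$ be a non-empty, compact and connected set. Then there exists a quasiconformal mapping $f:\mathbb{R}^n\to\mathbb{R}^n$ for which $X$ is the image of the point evaluation map $E_{x_1}:T(0,f)\to\mathbb{R}^n$, $E_{x_1}(\varphi)=\varphi(x_1)$, at the point $x_1=(1,0,\ldots,0)$; that is, $$\{\varphi(x_1):\varphi\in T(0,f)\}=X,$$ where $T(0,f)$ is the infinitesimal space of $f$ at $0$.
   Context: Quasiregular and quasiconformal maps: for a domain $U\subset\mathbb{R}^n$, a continuous mapping $f:U\to\mathbb{R}^n$ is quasiregular if $f$ lies in the Sobolev space $W^1_{n,\mathrm{loc}}(U)$ and there is $K\in[1,\infty)$ with $\|f'(x)\|^n\leq K J_f(x)$ for almost every $x\in U$, where $f'$ is the derivative matrix, $\|\cdot\|$ is the operator norm and $J_f$ is the Jacobian determinant. A quasiconformal map is an injective quasiregular map. Infinitesimal space: let $f:U\to\mathbb{R}^n$ be quasiregular on a domain $U$ and let $x_0\in U$. With $\lambda$ denoting Lebesgue measure and $B(x,r)$ the ball of radius $r$ centered at $x$, set $$\rho_f(r)=\left(\frac{\lambda[f(B(x_0,r))]}{\lambda[B(0,1)]}\right)^{1/n},\qquad f_t(x)=\frac{f(x_0+tx)-f(x_0)}{\rho_f(t)}\quad (t>0).$$ A generalized derivative of $f$ at $x_0$ is a map $\varphi:\mathbb{R}^n\to\mathbb{R}^n$ of the form $\varphi(x)=\lim_{k\to\infty}f_{t_k}(x)$ for some decreasing sequence $(t_k)$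 of positive numbers with $t_k\to 0$, the limit being locally uniform on $\mathbb{R}^n$. The infinitesimal space $T(x_0,f)$ is the set of all generalized derivatives of $f$ at $x_0$. *)

theory Defs
  imports "HOL-Analysis.Analysis"
begin

section \<open>Local Sobolev spaces\<close>

definition partial_deriv :: "'n::finite \<Rightarrow> (real^'n \<Rightarrow> real) \<Rightarrow> real^'n \<Rightarrow> real" where
  "partial_deriv j \<phi> x = frechet_derivative \<phi> (at x) (axis j 1)"

primrec C_k :: "nat \<Rightarrow> (real^'n::finite \<Rightarrow> real) \<Rightarrow> bool" where
  "C_k 0 \<phi> \<longleftrightarrow> continuous_on UNIV \<phi>"
| "C_k (Suc k) \<phi> \<longleftrightarrow> \<phi> differentiable_on UNIV \<and> (\<forall>j. C_k k (partial_deriv j \<phi>))"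

definition test_function :: "(real^'n::finite) set \<Rightarrow> (real^'n \<Rightarrow> real) \<Rightarrow> bool" where
  "test_function U \<phi> \<longleftrightarrow>
     (\<forall>k. C_k k \<phi>) \<and> compact (closure {x. \<phi> x \<noteq> 0}) \<and> closure {x. \<phi> x \<noteq> 0} \<subseteq> U"

definition L_loc :: "nat \<Rightarrow> (real^'n::finite) set \<Rightarrow> (real^'n \<Rightarrow> real) \<Rightarrow> bool" where
  "L_loc p U g \<longleftrightarrow>
     set_borel_measurable lebesgue U g \<and>
     (\<forall>C. compact C \<and> C \<subseteq> U \<longrightarrow> set_integrable lebesgue C (\<lambda>x. \<bar>g x\<bar> ^ p))"

text \<open>
  The \<open>(i, j)\<close> entry of the matrix \<open>D x\<close> is the weak derivative of the
  \<open>i\<close>-th component of \<open>f\<close> in direction \<open>j\<close>. For \<open>f\<close> and \<open>D\<close> locally integrable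
  both integrands are integrable, since \<open>\<phi>\<close> has compact support in \<open>U\<close>.
\<close>

definition weak_derivative ::
  "(real^'n::finite) set \<Rightarrow> (real^'n \<Rightarrow> real^'m::finite) \<Rightarrow> (real^'n \<Rightarrow> real^'n^'m) \<Rightarrow> bool" where
  "weak_derivative U f D \<longleftrightarrow>
     (\<forall>i j \<phi>. test_function U \<phi> \<longrightarrow>
        (LINT x:U|lebesgue. f x $ i * partial_deriv j \<phi> x) =
        - (LINT x:U|lebesgue. D x $ i $ j * \<phi> x))"

text \<open>
  \<open>f\<close> belongs to \<open>W\<^sup>1\<^sub>p\<^sub>,\<^sub>l\<^sub>o\<^sub>c(U)\<close>, with \<open>D\<close> a representative of its derivative matrix
  (which is determined up to null sets).
\<close>

definition sobolev_loc ::
  "nat \<Rightarrow> (real^'n::finite) set \<Rightarrow> (real^'n \<Rightarrow> real^'m::finite) \<Rightarrow> (real^'n \<Rightarrow> real^'n^'m) \<Rightarrow> bool"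
  where
  "sobolev_loc p U f D \<longleftrightarrow>
     (\<forall>i. L_loc p U (\<lambda>x. f x $ i)) \<and>
     (\<forall>i j. L_loc p U (\<lambda>x. D x $ i $ j)) \<and>
     weak_derivative U f D"


section \<open>Quasiregular and quasiconformal maps\<close>

definition quasiregular :: "(real^'n::finite) set \<Rightarrow> (real^'n \<Rightarrow> real^'n) \<Rightarrow> bool" where
  "quasiregular U f \<longleftrightarrow>
     open U \<and> connected U \<and> U \<noteq> {} \<and> continuous_on U f \<and>
     (\<exists>D. sobolev_loc CARD('n) U f D \<and>
        (\<exists>K\<ge>1. AE x in lebesgue. x \<in> U \<longrightarrow> onorm (\<lambda>v. D x *v v) ^ CARD('n) \<le> K * det (D x)))"

definition quasiconformal :: "(real^'n::finite) set \<Rightarrow> (real^'n \<Rightarrow> real^'n) \<Rightarrow> bool" where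
  "quasiconformal U f \<longleftrightarrow> quasiregular U f \<and> inj_on f U"


section \<open>Infinitesimal spaces\<close>

text \<open>
  The domain \<open>U\<close> of \<open>f\<close> is not a parameter below: if \<open>x0\<close> lies in the open set \<open>U\<close>, then
  for small \<open>t\<close> neither \<open>mean_radius f x0 t\<close> nor \<open>rescaling f x0 t\<close> on a given bounded set
  depends on values of \<open>f\<close> outside \<open>U\<close>.
\<close>

definition mean_radius :: "(real^'n::finite \<Rightarrow> real^'n) \<Rightarrow> real^'n \<Rightarrow> real \<Rightarrow> real" where
  "mean_radius f x0 r =
     (measure lebesgue (f ` ball x0 r) / measure lebesgue (ball (0 :: real^'n) 1))
       powr (1 / real CARD('n))"

definition rescaling :: "(real^'n::finite \<Rightarrow> real^'n) \<Rightarrow> real^'n \<Rightarrow> real \<Rightarrow> real^'n \<Rightarrow> real^'n" where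
  "rescaling f x0 t x = (f (x0 + t *\<^sub>R x) - f x0) /\<^sub>R mean_radius f x0 t"

definition locally_uniform_limit ::
  "(nat \<Rightarrow> 'a::metric_space \<Rightarrow> 'b::metric_space) \<Rightarrow> ('a \<Rightarrow> 'b) \<Rightarrow> bool" where
  "locally_uniform_limit F \<phi> \<longleftrightarrow>
     (\<forall>x. \<exists>e>0. uniform_limit (ball x e) F \<phi> sequentially)"

definition generalized_derivative ::
  "(real^'n::finite \<Rightarrow> real^'n) \<Rightarrow> real^'n \<Rightarrow> (real^'n \<Rightarrow> real^'n) \<Rightarrow> bool" where
  "generalized_derivative f x0 \<phi> \<longleftrightarrow>
     (\<exists>t :: nat \<Rightarrow> real. decseq t \<and> (\<forall>k. t k > 0) \<and> t \<longlonglongrightarrow> 0 \<and>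
        locally_uniform_limit (\<lambda>k. rescaling f x0 (t k)) \<phi>)"

definition infinitesimal_space ::
  "real^'n::finite \<Rightarrow> (real^'n \<Rightarrow> real^'n) \<Rightarrow> (real^'n \<Rightarrow> real^'n) set" where
  "infinitesimal_space x0 f = {\<phi>. generalized_derivative f x0 \<phi>}"

definition point_evaluation :: "'a \<Rightarrow> ('a \<Rightarrow> 'b) \<Rightarrow> 'b" where
  "point_evaluation x \<phi> = \<phi> x"

end

theory Submission imports Defs begin

text \<open>
  Take \<open>f x = A (ln \<bar>x\<bar>) x\<close> with matrices \<open>A u\<close> from a compact set of matrices of positive
  determinant, where \<open>A\<close> has a small Lipschitz constant, tending to \<open>0\<close> as \<open>u \<rightarrow> -\<infinity>\<close>. Then \<open>f\<close> is
  bilipschitz and its derivative is close to \<open>A (ln \<bar>x\<bar>)\<close>, so \<open>f\<close> is quasiconformal. Since \<open>f\<close> agrees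
  with \<open>A (ln r)\<close> on the sphere of radius \<open>r\<close>, it maps the ball of radius \<open>r\<close> onto the same set as
  \<open>A (ln r)\<close>, and the generalized derivatives of \<open>f\<close> at \<open>0\<close> are exactly the volume-normalized
  limits of \<open>A u\<close> as \<open>u \<rightarrow> -\<infinity>\<close>. It remains to let the normalized value of \<open>A u\<close> at the unit
  vector accumulate exactly on \<open>X\<close>. As \<open>X\<close> is connected, any two of its points are joined by chains in
  \<open>X\<close> with arbitrarily short steps; such chains lift to chains of matrices \<open>R D\<close> with \<open>R\<close> a
  rotation and \<open>D\<close> a stretching along the unit vector, because nearby directions are carried to
  one another by rotations close to the identity. Joining infinitely many chains and interpolating linearly yields \<open>A\<close>.
\<close>

section \<open>Matrices\<close>

text \<open>The norm of a matrix is here the Euclidean norm of its entries, so Cauchy-Schwarz in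
  every row is enough.\<close>

lemma norm_matrix_vector_mult_le:
  fixes A :: "real^'n^'m"
  shows "norm (A *v x) \<le> norm A * norm x"
proof -
  have "norm (A *v x) = L2_set (\<lambda>i. norm ((A *v x) $ i)) UNIV"
    by (simp add: norm_vec_def)
  also have "\<dots> \<le> L2_set (\<lambda>i. norm (A $ i) * norm x) UNIV"
    by (intro L2_set_mono) (auto simp: matrix_vector_mul_component Cauchy_Schwarz_ineq2)
  also have "\<dots> = norm A * norm x"
    by (simp add: norm_vec_def L2_set_left_distrib)
  finally show ?thesis .
qed

lemma bounded_bilinear_matrix_vector_mult:
  "bounded_bilinear ((*v) :: real^'n^'m \<Rightarrow> _)"
proof
  show "\<exists>K. \<forall>(A::real^'n^'m) x. norm (A *v x) \<le> norm A * norm x * K"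
    by (rule exI[of _ 1]) (simp add: norm_matrix_vector_mult_le)
qed (simp_all add: matrix_vector_mult_add_rdistrib matrix_vector_right_distrib matrix_vector_mult_scaleR
    scaleR_matrix_vector_assoc)

lemmas continuous_on_matrix_vector_mult [continuous_intros] =
  bounded_bilinear.continuous_on[OF bounded_bilinear_matrix_vector_mult]
lemmas has_derivative_matrix_vector_mult =
  bounded_bilinear.FDERIV[OF bounded_bilinear_matrix_vector_mult]

lemma continuous_on_matrix_mult [continuous_intros]:
  fixes f :: "'a::topological_space \<Rightarrow> real^'n^'m" and g :: "'a \<Rightarrow> real^'p^'n"
  assumes "continuous_on S f" "continuous_on S g"
  shows "continuous_on S (\<lambda>x. f x ** g x)"
  unfolding matrix_matrix_mult_def by (intro continuous_intros assms)

lemma continuous_on_matrix_det [continuous_intros]: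
  fixes f :: "'a::topological_space \<Rightarrow> real^'n^'n"
  assumes "continuous_on S f"
  shows "continuous_on S (\<lambda>x. det (f x))"
  unfolding det_def by (intro continuous_intros assms)

text \<open>For \<open>c > 0\<close> a compact set of invertible, orientation-preserving matrices.
  Compactness makes the constants of the following lemmas uniform over it.\<close>

definition nondeg :: "real \<Rightarrow> real \<Rightarrow> (real^'n^'n) set" where
  "nondeg c C = {A. c \<le> det A \<and> norm A \<le> C}"

lemma nondegD: "A \<in> nondeg c C \<Longrightarrow> c \<le> det A" "A \<in> nondeg c C \<Longrightarrow> norm A \<le> C"
  by (auto simp: nondeg_def)

lemma compact_nondeg: "compact (nondeg c C :: (real^'n^'n) set)"
proof (rule compact_eq_bounded_closed[THEN iffD2], intro conjI)
  show "bounded (nondeg c C :: (real^'n^'n) set)"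
    by (rule boundedI[of _ C]) (auto simp: nondeg_def)
  show "closed (nondeg c C :: (real^'n^'n) set)"
    unfolding nondeg_def
    by (intro closed_Collect_conj closed_Collect_le continuous_intros)
qed

text \<open>\<open>norm (A *v v)\<close> attains its minimum on the product of the compact set with
  the unit sphere, and the minimum is positive because the minimizing matrix is invertible.\<close>

lemma nondeg_lower_bound:
  assumes "c > 0"
  obtains m where "m > 0" "\<And>A (v::real^'n). A \<in> nondeg c C \<Longrightarrow> norm (A *v v) \<ge> m * norm v"
proof (cases "(nondeg c C :: (real^'n^'n) set) = {}")
  case True
  then show ?thesis using that[of 1] by auto
next
  case False
  let ?S = "(nondeg c C :: (real^'n^'n) set) \<times> sphere (0::real^'n) 1"
  have "compact ?S" by (intro compact_Times compact_nondeg compact_sphere)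
  moreover have "?S \<noteq> {}" using False vector_choose_size[of 1, where 'a="real^'n"] by auto
  moreover have "continuous_on ?S (\<lambda>z. norm (fst z *v snd z))"
    by (intro continuous_on_norm continuous_on_matrix_vector_mult continuous_on_fst continuous_on_snd
        continuous_on_id)
  ultimately have "\<exists>z\<in>?S. \<forall>y\<in>?S. norm (fst z *v snd z) \<le> norm (fst y *v snd y)"
    by (rule continuous_attains_inf)
  then obtain z where z: "z \<in> ?S" "\<And>y. y \<in> ?S \<Longrightarrow> norm (fst z *v snd z) \<le> norm (fst y *v snd y)"
    by (elim bexE) (rule that, assumption, erule (1) bspec)
  define m where "m = norm (fst z *v snd z)"
  have "det (fst z) \<noteq> 0" "snd z \<noteq> 0"
    using z(1) assms by (auto simp: nondeg_def)
  then have "m > 0"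
    unfolding m_def
    using injD[OF inj_matrix_vector_mult[of "fst z"], of "snd z" 0] by (force simp: invertible_det_nz)
  moreover have "norm (A *v v) \<ge> m * norm v" if "A \<in> nondeg c C" for A and v :: "real^'n"
  proof (cases "v = 0")
    case False
    have "m \<le> norm (A *v (v /\<^sub>R norm v))"
      unfolding m_def using z(2)[of "(A, v /\<^sub>R norm v)"] that False by auto
    also have "\<dots> = norm (A *v v) / norm v"
      by (simp add: matrix_vector_mult_scaleR divide_inverse_commute)
    finally show ?thesis using False by (simp add: field_simps)
  qed simp
  ultimately show ?thesis using that by blast
qed

text \<open>Uniform continuity of \<open>det\<close> on a compact ball; its radius
  \<open>C+1\<close> leaves room for perturbations shorter than 1.\<close>

lemma nondeg_perturb:
  assumes "c > c'"
  obtains d where "d > 0"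
    "\<And>A B :: real^'n^'n. A \<in> nondeg c C \<Longrightarrow> dist B A < d \<Longrightarrow> det B \<ge> c'"
proof -
  have "uniformly_continuous_on (cball (0::real^'n^'n) (C+1)) det"
    by (intro compact_uniformly_continuous continuous_intros) auto
  then obtain d where d: "d > 0" "\<And>A B :: real^'n^'n. A \<in> cball 0 (C+1) \<Longrightarrow> B \<in> cball 0 (C+1) \<Longrightarrow>
      dist B A < d \<Longrightarrow> dist (det B) (det A) < c - c'"
    unfolding uniformly_continuous_on_def using assms[THEN diff_gt_0_iff_gt[THEN iffD2]] by blast
  show ?thesis
  proof
    show "min d 1 > 0" using d by simp
    fix A B :: "real^'n^'n"
    assume A: "A \<in> nondeg c C" and B: "dist B A < min d 1"
    have "norm B \<le> norm A + dist B A"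
      by (metis dist_norm norm_triangle_sub)
    then have "A \<in> cball 0 (C+1)" "B \<in> cball 0 (C+1)"
      using A B by (auto simp: nondeg_def)
    with d(2)[OF this] B have "dist (det B) (det A) < c - c'" by simp
    then show "det B \<ge> c'" using A by (auto simp: nondeg_def dist_real_def)
  qed
qed

section \<open>Weak derivatives of Lipschitz maps\<close>

lemma tendsto_directional_quotient:
  fixes g :: "'a::real_normed_vector \<Rightarrow> real"
  assumes "(g has_derivative g') (at x)"
  shows "((\<lambda>h. (g (x + h *\<^sub>R v) - g x) / h) \<longlongrightarrow> g' v) (at 0)"
proof -
  have g': "(g has_derivative g') (at (x + 0 *\<^sub>R v))" using assms by simp
  have "((\<lambda>h. g (x + h *\<^sub>R v)) has_derivative (\<lambda>h. g' (h *\<^sub>R v))) (at 0)"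
    by (rule has_derivative_compose[of "\<lambda>h. x + h *\<^sub>R v" "\<lambda>h. h *\<^sub>R v" 0 UNIV g g', OF _ g']) (auto intro!: derivative_eq_intros)
  moreover have "(\<lambda>h. g' (h *\<^sub>R v)) = (*) (g' v)"
    using has_derivative_bounded_linear[OF assms] by (auto simp: linear_simps)
  ultimately have "((\<lambda>h. g (x + h *\<^sub>R v)) has_field_derivative g' v) (at 0)"
    by (simp add: has_field_derivative_def)
  then show ?thesis by (simp add: DERIV_def)
qed

text \<open>Both signs occur because moving a forward difference quotient from a test function to
  \<open>f\<close> turns it into a backward one.\<close>

lemma filterlim_inverse_Suc_at_0:
  "filterlim (\<lambda>n. 1 / real (Suc n)) (at 0) sequentially"
  "filterlim (\<lambda>n. - (1 / real (Suc n))) (at 0) sequentially"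
proof -
  have *: "(\<lambda>n. 1 / real (Suc n)) \<longlonglongrightarrow> 0"
    by (rule LIMSEQ_Suc[OF lim_1_over_n])
  show "filterlim (\<lambda>n. 1 / real (Suc n)) (at 0) sequentially"
    using * by (auto simp: filterlim_at)
  show "filterlim (\<lambda>n. - (1 / real (Suc n))) (at 0) sequentially"
    using tendsto_minus[OF *] by (auto simp: filterlim_at)
qed

lemma partial_deriv_eq:
  assumes "(\<phi> has_derivative \<phi>') (at x)"
  shows "partial_deriv j \<phi> x = \<phi>' (axis j 1)"
  unfolding partial_deriv_def by (simp add: frechet_derivative_at[OF assms, symmetric])

section \<open>Test functions and their partial derivatives\<close>

context
  fixes \<phi> :: "real^'n \<Rightarrow> real" and j :: 'n
  assumes tf: "test_function UNIV \<phi>"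
begin

lemma test_function_has_derivative: "(\<phi> has_derivative frechet_derivative \<phi> (at x)) (at x)"
proof -
  have "C_k (Suc 0) \<phi>" using tf by (simp only: test_function_def)
  then show ?thesis by (simp add: differentiable_on_def frechet_derivative_works)
qed

lemma test_function_continuous: "continuous_on S \<phi>"
proof -
  have "C_k 0 \<phi>" using tf by (simp only: test_function_def)
  then show ?thesis by (auto intro: continuous_on_subset)
qed

lemma partial_deriv_continuous: "continuous_on S (partial_deriv j \<phi>)"
proof -
  have "C_k (Suc 0) \<phi>" using tf by (simp only: test_function_def)
  then have "C_k 0 (partial_deriv j \<phi>)" by simp
  then show ?thesis by (auto intro: continuous_on_subset)
qed

lemma test_function_compact: "compact (closure {x. \<phi> x \<noteq> 0})"
  using tf by (auto simp: test_function_def)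

lemma test_function_outside: "x \<notin> closure {x. \<phi> x \<noteq> 0} \<Longrightarrow> \<phi> x = 0"
  by (metis (mono_tags, lifting) closure_subset mem_Collect_eq subsetD)

lemma partial_deriv_outside:
  assumes "x \<notin> closure {x. \<phi> x \<noteq> 0}"
  shows "partial_deriv j \<phi> x = 0"
proof -
  have "(\<phi> has_derivative (\<lambda>_. 0)) (at x)"
  proof (rule has_derivative_transform_within_open)
    show "((\<lambda>_. 0) has_derivative (\<lambda>_. 0)) (at x)" by simp
    show "open (- closure {x. \<phi> x \<noteq> 0})" by (intro open_Compl closed_closure)
    show "x \<in> - closure {x. \<phi> x \<noteq> 0}" using assms by simp
    show "0 = \<phi> y" if "y \<in> - closure {x. \<phi> x \<noteq> 0}" for y
      using test_function_outside[of y] that by (metis ComplD)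
  qed
  then show ?thesis by (simp add: partial_deriv_eq)
qed

text \<open>The partial derivative is continuous and vanishes off a compact set, hence is bounded,
  and the mean value inequality applies along lines. The bound later dominates the difference
  quotients of the test function.\<close>

lemma test_function_quotient_bound:
  obtains M where "M \<ge> 0" "\<And>x h. \<bar>\<phi> (x + h *\<^sub>R axis j 1) - \<phi> x\<bar> \<le> M * \<bar>h\<bar>"
proof -
  have "bounded (partial_deriv j \<phi> ` closure {x. \<phi> x \<noteq> 0})"
    by (intro compact_imp_bounded compact_continuous_image partial_deriv_continuous test_function_compact)
  then obtain M where M: "M > 0" "\<And>x. x \<in> closure {x. \<phi> x \<noteq> 0} \<Longrightarrow> \<bar>partial_deriv j \<phi> x\<bar> \<le> M"
    by (force simp: bounded_pos)
  have M': "\<bar>partial_deriv j \<phi> x\<bar> \<le> M" for x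
    using M partial_deriv_outside[of x] by (cases "x \<in> closure {x. \<phi> x \<noteq> 0}") auto
  have "\<bar>\<phi> (x + h *\<^sub>R axis j 1) - \<phi> x\<bar> \<le> M * \<bar>h\<bar>" for x h
  proof -
    have "((\<lambda>t. \<phi> (x + t *\<^sub>R axis j 1)) has_field_derivative partial_deriv j \<phi> (x + t *\<^sub>R axis j 1)) (at t)" for t
    proof -
      have "((\<lambda>t. \<phi> (x + t *\<^sub>R axis j 1)) has_derivative
          (\<lambda>h. frechet_derivative \<phi> (at (x + t *\<^sub>R axis j 1)) (h *\<^sub>R axis j 1))) (at t)"
        by (rule has_derivative_compose[of "\<lambda>t. x + t *\<^sub>R axis j 1" "\<lambda>h. h *\<^sub>R axis j 1" t UNIV \<phi>,
              OF _ test_function_has_derivative]) (auto intro!: derivative_eq_intros)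
      moreover have "(\<lambda>h. frechet_derivative \<phi> (at (x + t *\<^sub>R axis j 1)) (h *\<^sub>R axis j 1))
          = (*) (partial_deriv j \<phi> (x + t *\<^sub>R axis j 1))"
        using has_derivative_bounded_linear[OF test_function_has_derivative, of "x + t *\<^sub>R axis j 1"]
        by (auto simp: linear_simps partial_deriv_def)
      ultimately show ?thesis by (simp add: has_field_derivative_def)
    qed
    then have "norm (\<phi> (x + h *\<^sub>R axis j 1) - \<phi> (x + 0 *\<^sub>R axis j 1)) \<le> M * norm (h - 0)"
      by (intro field_differentiable_bound[OF convex_UNIV, where f = "\<lambda>t. \<phi> (x + t *\<^sub>R axis j 1)"]) (auto simp: M')
    then show ?thesis by simp
  qed
  with M(1) show ?thesis by (intro that[of M]) auto
qed

end

lemma integrable_compact_support: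
  fixes g :: "'a::euclidean_space \<Rightarrow> real"
  assumes "compact S" "continuous_on UNIV g" "\<And>x. x \<notin> S \<Longrightarrow> g x = 0"
  shows "integrable lebesgue g"
proof -
  have "integrable lborel (\<lambda>x. indicator S x *\<^sub>R g x)"
    using assms by (intro borel_integrable_compact) (auto intro: continuous_on_subset)
  moreover have "(\<lambda>x. indicator S x *\<^sub>R g x) = g"
    using assms(3) by (auto simp: fun_eq_iff indicator_def)
  ultimately have "integrable lborel g" by simp
  then show ?thesis
    using borel_measurable_continuous_onI[OF assms(2)] by (simp add: integrable_completion)
qed

text \<open>Continuity makes both integrands Borel, so translation invariance of
  \<open>lborel\<close> carries over to its completion.\<close>

lemma integral_lebesgue_translation:
  fixes g :: "'a::euclidean_space \<Rightarrow> real"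
  assumes "continuous_on UNIV g"
  shows "(LINT x|lebesgue. g (c + x)) = (LINT x|lebesgue. g x)"
proof -
  have m: "g \<in> borel_measurable borel" "(\<lambda>x. g (c + x)) \<in> borel_measurable borel"
    by (auto intro!: borel_measurable_continuous_onI continuous_on_compose2[OF assms] continuous_intros assms)
  have "(LINT x|lborel. g x) = (LINT x|distr lborel borel ((+) c). g x)"
    by (simp add: lborel_distr_plus)
  also have "\<dots> = (LINT x|lborel. g (c + x))"
    using m by (subst integral_distr) auto
  finally show ?thesis
    using m by (simp add: integral_completion)
qed

section \<open>Lipschitz maps that are differentiable off a null set\<close>

context
  fixes f :: "real^'n \<Rightarrow> real^'m" and D :: "real^'n \<Rightarrow> real^'n^'m" and L :: real and N :: "(real^'n) set"
  assumes lip: "\<And>x y. norm (f x - f y) \<le> L * norm (x - y)"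
    and null: "N \<in> null_sets lebesgue"
    and deriv: "\<And>x. x \<notin> N \<Longrightarrow> (f has_derivative (\<lambda>v. D x *v v)) (at x)"
    and zero_on_null: "\<And>x. x \<in> N \<Longrightarrow> D x = 0"
begin

lemma lipschitz_nonneg: "0 \<le> L"
  using order_trans[OF norm_ge_zero lip[of "axis undefined 1" 0]] by simp

lemma lipschitz_component: "\<bar>f x $ i - f y $ i\<bar> \<le> L * norm (x - y)"
  using Finite_Cartesian_Product.norm_nth_le[of "f x - f y" i] lip[of x y] by simp

lemma lipschitz_continuous_component: "continuous_on S (\<lambda>x. f x $ i)"
proof -
  have "L-lipschitz_on S (\<lambda>x. f x $ i)"
    using lipschitz_component lipschitz_nonneg by (auto intro!: lipschitz_onI simp: dist_norm)
  then show ?thesis by (rule lipschitz_on_continuous_on)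
qed

lemma quotient_limit_component:
  assumes "x \<notin> N"
  shows "((\<lambda>h. (f (x + h *\<^sub>R axis j 1) $ i - f x $ i) / h) \<longlongrightarrow> D x $ i $ j) (at 0)"
proof -
  have "((\<lambda>x. f x $ i) has_derivative (\<lambda>v. (D x *v v) $ i)) (at x)"
    by (rule bounded_linear.has_derivative[OF bounded_linear_vec_nth deriv[OF assms]])
  from tendsto_directional_quotient[OF this, of "axis j 1"] show ?thesis
    by (simp add: matrix_vector_mult_basis column_def)
qed

lemma quotient_component_bound: "\<bar>(f (x + h *\<^sub>R axis j 1) $ i - f x $ i) / h\<bar> \<le> L"
proof (cases "h = 0")
  case False
  then show ?thesis using lipschitz_component[of "x + h *\<^sub>R axis j 1" i x] by (simp add: field_simps)
qed (simp add: lipschitz_nonneg)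

lemma derivative_component_bound: "\<bar>D x $ i $ j\<bar> \<le> L"
proof (cases "x \<in> N")
  case False
  show ?thesis
    by (rule tendsto_upperbound[OF tendsto_rabs[OF quotient_limit_component[OF False, of j i]]])
      (auto simp del: abs_divide intro!: always_eventually quotient_component_bound)
qed (simp add: zero_on_null lipschitz_nonneg)

lemma borel_measurable_component: "(\<lambda>x. f x $ i) \<in> borel_measurable borel"
  by (intro borel_measurable_continuous_onI lipschitz_continuous_component)

text \<open>Off \<open>N\<close> every entry is a limit of continuous difference quotients; on
  \<open>N\<close> the approximants are cut off to \<open>0\<close>, which agrees with the
  normalization \<open>D x = 0\<close> there.\<close>

lemma lebesgue_measurable_derivative: "(\<lambda>x. D x $ i $ j) \<in> borel_measurable lebesgue"
proof (rule borel_measurable_LIMSEQ_real)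
  let ?h = "\<lambda>n. 1 / real (Suc n)"
  let ?u = "\<lambda>n x. indicator (- N) x * ((f (x + ?h n *\<^sub>R axis j 1) $ i - f x $ i) / ?h n)"
  show "(\<lambda>n. ?u n x) \<longlonglongrightarrow> D x $ i $ j" for x
  proof (cases "x \<in> N")
    case False
    then show ?thesis
      using filterlim_compose[OF quotient_limit_component[OF False] filterlim_inverse_Suc_at_0(1)] by simp
  qed (simp add: zero_on_null)
  show "?u n \<in> borel_measurable lebesgue" for n
  proof -
    have "(\<lambda>x. (f (x + ?h n *\<^sub>R axis j 1) $ i - f x $ i) / ?h n) \<in> borel_measurable borel"
      by (intro borel_measurable_continuous_onI continuous_intros
          continuous_on_compose2[OF lipschitz_continuous_component[of UNIV]]) auto
    then have "(\<lambda>x. (f (x + ?h n *\<^sub>R axis j 1) $ i - f x $ i) / ?h n) \<in> borel_measurable lebesgue"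
      by (simp add: measurable_completion)
    moreover have "indicator (- N) \<in> borel_measurable lebesgue"
      using null by (intro borel_measurable_indicator) (auto simp: Compl_eq_Diff_UNIV)
    ultimately show ?thesis by (intro borel_measurable_times)
  qed
qed

lemma L_loc_component: "L_loc p UNIV (\<lambda>x. f x $ i)"
  unfolding L_loc_def
proof (intro conjI allI impI)
  show "set_borel_measurable lebesgue UNIV (\<lambda>x. f x $ i)"
    using borel_measurable_component by (simp add: set_borel_measurable_def measurable_completion)
  fix C :: "(real^'n) set" assume C: "compact C \<and> C \<subseteq> UNIV"
  have int: "integrable lborel (\<lambda>x. indicator C x *\<^sub>R (\<bar>f x $ i\<bar> ^ p))"
    using C by (intro borel_integrable_compact continuous_intros lipschitz_continuous_component) auto
  then show "set_integrable lebesgue C (\<lambda>x. \<bar>f x $ i\<bar> ^ p)"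
    unfolding set_integrable_def by (subst integrable_completion) (use borel_measurable_integrable[OF int] in auto)
qed

lemma L_loc_derivative: "L_loc p UNIV (\<lambda>x. D x $ i $ j)"
  unfolding L_loc_def
proof (intro conjI allI impI)
  show "set_borel_measurable lebesgue UNIV (\<lambda>x. D x $ i $ j)"
    using lebesgue_measurable_derivative by (simp add: set_borel_measurable_def)
  fix C :: "(real^'n) set" assume C: "compact C \<and> C \<subseteq> UNIV"
  have [measurable]: "C \<in> sets lebesgue" using C by (intro lmeasurable_compact[THEN fmeasurableD]) auto
  note lebesgue_measurable_derivative[measurable]
  have int: "integrable lborel (\<lambda>x. indicator C x *\<^sub>R (L ^ p))"
    using C by (intro borel_integrable_compact continuous_intros) auto
  then have "integrable lebesgue (\<lambda>x. indicator C x *\<^sub>R (L ^ p))"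
    by (subst integrable_completion) (use borel_measurable_integrable[OF int] in auto)
  then show "set_integrable lebesgue C (\<lambda>x. \<bar>D x $ i $ j\<bar> ^ p)"
    unfolding set_integrable_def
  proof (rule Bochner_Integration.integrable_bound)
    show "(\<lambda>x. indicator C x *\<^sub>R (\<bar>D x $ i $ j\<bar> ^ p)) \<in> borel_measurable lebesgue"
      by measurable
    show "AE x in lebesgue. norm (indicator C x *\<^sub>R (\<bar>D x $ i $ j\<bar> ^ p)) \<le> norm (indicator C x *\<^sub>R (L ^ p))"
      using derivative_component_bound lipschitz_nonneg
      by (intro AE_I2) (auto simp: indicator_def power_mono)
  qed
qed

text \<open>Integration by parts is done first for difference quotients, where it is a translation
  of the variable. Dominated convergence then passes to the limit on both sides, with bounds from
  the Lipschitz constants and the compact support.\<close>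

lemma weak_derivative_lipschitz: "weak_derivative UNIV f D"
  unfolding weak_derivative_def
proof (intro allI impI)
  fix i j and \<phi> :: "real^'n \<Rightarrow> real"
  assume tf: "test_function UNIV \<phi>"
  let ?h = "\<lambda>n. 1 / real (Suc n)"
  let ?e = "axis j 1 :: real^'n"
  let ?g = "\<lambda>x. f x $ i"
  define S where "S = closure {x. \<phi> x \<noteq> 0}"
  \<comment> \<open>The steps \<open>?h n\<close> are at most 1, so the 1-neighbourhood
    \<open>T\<close> of the support contains the supports of all shifted copies of
    \<open>\<phi>\<close>.\<close>
  define T where "T = {x + y |x y. x \<in> S \<and> y \<in> cball 0 1}"
  have S: "compact S" unfolding S_def by (rule test_function_compact[OF tf])
  then have T: "compact T" unfolding T_def by (intro compact_sums compact_cball)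
  have ST: "S \<subseteq> T" unfolding T_def by force
  note cnt = test_function_continuous[OF tf] lipschitz_continuous_component
    continuous_on_compose2[OF test_function_continuous[OF tf, of UNIV]]
    continuous_on_compose2[OF lipschitz_continuous_component[of UNIV]]
    partial_deriv_continuous[OF tf]
  have \<phi>0: "\<phi> x = 0" if "x \<notin> S" for x using that unfolding S_def by (rule test_function_outside[OF tf])
  have shift: "x + ?h n *\<^sub>R ?e \<notin> S" if "x \<notin> T" for x n
  proof
    assume "x + ?h n *\<^sub>R ?e \<in> S"
    moreover have "- (?h n *\<^sub>R ?e) \<in> cball 0 1" by simp
    moreover have "x = (x + ?h n *\<^sub>R ?e) + - (?h n *\<^sub>R ?e)" by simp
    ultimately show False using that unfolding T_def by blast
  qed
  obtain M where M: "M \<ge> 0" "\<And>x h. \<bar>\<phi> (x + h *\<^sub>R ?e) - \<phi> x\<bar> \<le> M * \<bar>h\<bar>"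
    using test_function_quotient_bound[OF tf, of j] by blast
  \<comment> \<open>In the term with the shifted \<open>\<phi>\<close>, replacing \<open>x\<close>
    by \<open>x - ?h n *\<^sub>R ?e\<close> shifts \<open>f\<close> backwards instead; this produces
    the quotient with step \<open>- ?h n\<close>.\<close>
  have *: "(LINT x|lebesgue. ?g x * ((\<phi> (x + ?h n *\<^sub>R ?e) - \<phi> x) / ?h n))
      = (LINT x|lebesgue. - ((?g (x - ?h n *\<^sub>R ?e) - ?g x) / - ?h n * \<phi> x))" for n
  proof -
    let ?c = "?h n *\<^sub>R ?e"
    have i1: "integrable lebesgue (\<lambda>x. ?g x * \<phi> (x + ?c))"
    proof (rule integrable_compact_support[OF T])
      show "?g x * \<phi> (x + ?c) = 0" if "x \<notin> T" for x using \<phi>0[OF shift[OF that]] by simp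
    qed (intro continuous_intros cnt; simp)
    have i2: "integrable lebesgue (\<lambda>x. ?g x * \<phi> x)"
      by (rule integrable_compact_support[OF S]) (auto intro!: continuous_intros cnt simp: \<phi>0)
    have c3: "continuous_on UNIV (\<lambda>x. ?g (x - ?c) * \<phi> x)"
      by (intro continuous_intros cnt; simp)
    have i3: "integrable lebesgue (\<lambda>x. ?g (x - ?c) * \<phi> x)"
      by (rule integrable_compact_support[OF S c3]) (simp add: \<phi>0)
    have "(LINT x|lebesgue. ?g x * \<phi> (x + ?c)) = (LINT x|lebesgue. ?g ((?c + x) - ?c) * \<phi> (?c + x))"
      by (simp add: add.commute)
    also have "\<dots> = (LINT x|lebesgue. ?g (x - ?c) * \<phi> x)"
      by (rule integral_lebesgue_translation[OF c3])
    finally have eq: "(LINT x|lebesgue. ?g x * \<phi> (x + ?c)) = (LINT x|lebesgue. ?g (x - ?c) * \<phi> x)" .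
    have "(LINT x|lebesgue. ?g x * ((\<phi> (x + ?c) - \<phi> x) / ?h n))
        = (LINT x|lebesgue. (?g x * \<phi> (x + ?c) - ?g x * \<phi> x) * real (Suc n))"
      by (intro Bochner_Integration.integral_cong) (auto simp: field_simps)
    also have "\<dots> = (LINT x|lebesgue. (?g (x - ?c) * \<phi> x - ?g x * \<phi> x) * real (Suc n))"
      using i1 i2 i3 eq by (simp del: of_nat_Suc)
    also have "\<dots> = (LINT x|lebesgue. - ((?g (x - ?c) - ?g x) / - ?h n * \<phi> x))"
      by (intro Bochner_Integration.integral_cong) (auto simp: field_simps)
    finally show ?thesis .
  qed
  have lim1: "(\<lambda>n. LINT x|lebesgue. ?g x * ((\<phi> (x + ?h n *\<^sub>R ?e) - \<phi> x) / ?h n))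
      \<longlonglongrightarrow> (LINT x|lebesgue. ?g x * partial_deriv j \<phi> x)"
  proof (rule integral_dominated_convergence[where w = "\<lambda>x. indicator T x *\<^sub>R (\<bar>?g x\<bar> * M)"])
    show "(\<lambda>x. ?g x * partial_deriv j \<phi> x) \<in> borel_measurable lebesgue"
      by (intro measurable_completion) (auto intro!: borel_measurable_continuous_onI continuous_intros cnt)
    show "(\<lambda>x. ?g x * ((\<phi> (x + ?h n *\<^sub>R ?e) - \<phi> x) / ?h n)) \<in> borel_measurable lebesgue" for n
      by (intro measurable_completion) (auto intro!: borel_measurable_continuous_onI continuous_intros cnt)
    have int: "integrable lborel (\<lambda>x. indicator T x *\<^sub>R (\<bar>?g x\<bar> * M))"
      by (intro borel_integrable_compact T continuous_intros cnt)
    then show "integrable lebesgue (\<lambda>x. indicator T x *\<^sub>R (\<bar>?g x\<bar> * M))"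
      by (subst integrable_completion) (use borel_measurable_integrable[OF int] in auto)
    show "AE x in lebesgue. (\<lambda>n. ?g x * ((\<phi> (x + ?h n *\<^sub>R ?e) - \<phi> x) / ?h n)) \<longlonglongrightarrow> ?g x * partial_deriv j \<phi> x"
      unfolding partial_deriv_def
      by (intro AE_I2 tendsto_mult tendsto_const filterlim_compose[OF _ filterlim_inverse_Suc_at_0(1)]
          tendsto_directional_quotient test_function_has_derivative[OF tf])
    show "AE x in lebesgue. norm (?g x * ((\<phi> (x + ?h n *\<^sub>R ?e) - \<phi> x) / ?h n)) \<le> indicator T x *\<^sub>R (\<bar>?g x\<bar> * M)" for n
    proof (intro AE_I2)
      fix x
      show "norm (?g x * ((\<phi> (x + ?h n *\<^sub>R ?e) - \<phi> x) / ?h n)) \<le> indicator T x *\<^sub>R (\<bar>?g x\<bar> * M)"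
      proof (cases "x \<in> T")
        case True
        have "\<bar>(\<phi> (x + ?h n *\<^sub>R ?e) - \<phi> x) / ?h n\<bar> \<le> M"
          using M(2)[of x "?h n"] by (simp add: abs_mult pos_le_divide_eq del: of_nat_Suc)
        then show ?thesis using True by (simp add: abs_mult mult_left_mono del: of_nat_Suc abs_divide)
      next
        case False
        then have "\<phi> (x + ?h n *\<^sub>R ?e) = 0" "\<phi> x = 0" using \<phi>0 shift ST by blast+
        then show ?thesis using False by simp
      qed
    qed
  qed
  have lim2: "(\<lambda>n. LINT x|lebesgue. - ((?g (x - ?h n *\<^sub>R ?e) - ?g x) / - ?h n * \<phi> x))
      \<longlonglongrightarrow> (LINT x|lebesgue. - (D x $ i $ j * \<phi> x))"
  proof (rule integral_dominated_convergence[where w = "\<lambda>x. L * \<bar>\<phi> x\<bar>"])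
    have "\<phi> \<in> borel_measurable lebesgue"
      by (intro measurable_completion) (auto intro!: borel_measurable_continuous_onI cnt)
    then show "(\<lambda>x. - (D x $ i $ j * \<phi> x)) \<in> borel_measurable lebesgue"
      by (intro borel_measurable_uminus borel_measurable_times lebesgue_measurable_derivative)
    show "(\<lambda>x. - ((?g (x - ?h n *\<^sub>R ?e) - ?g x) / - ?h n * \<phi> x)) \<in> borel_measurable lebesgue" for n
      by (intro measurable_completion, unfold measurable_lborel2)
        (intro borel_measurable_continuous_onI continuous_intros cnt; simp)
    show "integrable lebesgue (\<lambda>x. L * \<bar>\<phi> x\<bar>)"
      by (rule integrable_compact_support[OF S]) (auto intro!: continuous_intros cnt simp: \<phi>0)
    show "AE x in lebesgue. (\<lambda>n. - ((?g (x - ?h n *\<^sub>R ?e) - ?g x) / - ?h n * \<phi> x)) \<longlonglongrightarrow> - (D x $ i $ j * \<phi> x)"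
    proof (rule AE_I'[OF null], rule subsetI)
      fix x
      assume "x \<in> {x \<in> space lebesgue. \<not> (\<lambda>n. - ((?g (x - ?h n *\<^sub>R ?e) - ?g x) / - ?h n * \<phi> x)) \<longlonglongrightarrow> - (D x $ i $ j * \<phi> x)}"
      moreover have "(\<lambda>n. - ((?g (x - ?h n *\<^sub>R ?e) - ?g x) / - ?h n * \<phi> x)) \<longlonglongrightarrow> - (D x $ i $ j * \<phi> x)"
        if "x \<notin> N"
        using filterlim_compose[OF quotient_limit_component[OF that, of j i] filterlim_inverse_Suc_at_0(2)]
        by (intro tendsto_minus tendsto_mult tendsto_const) (simp del: of_nat_Suc)
      ultimately show "x \<in> N" by blast
    qed
    show "AE x in lebesgue. norm (- ((?g (x - ?h n *\<^sub>R ?e) - ?g x) / - ?h n * \<phi> x)) \<le> L * \<bar>\<phi> x\<bar>" for n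
    proof (intro AE_I2)
      fix x
      have "\<bar>(?g (x - ?h n *\<^sub>R ?e) - ?g x) / - ?h n\<bar> \<le> L"
        using quotient_component_bound[of x "- ?h n" j i] by (simp del: of_nat_Suc)
      then show "norm (- ((?g (x - ?h n *\<^sub>R ?e) - ?g x) / - ?h n * \<phi> x)) \<le> L * \<bar>\<phi> x\<bar>"
        unfolding real_norm_def abs_minus_cancel abs_mult by (rule mult_right_mono) simp
    qed
  qed
  have "(LINT x|lebesgue. ?g x * partial_deriv j \<phi> x) = (LINT x|lebesgue. - (D x $ i $ j * \<phi> x))"
    by (rule LIMSEQ_unique[OF lim1]) (use lim2 in \<open>simp only: *\<close>)
  then show "(LINT x:UNIV|lebesgue. f x $ i * partial_deriv j \<phi> x) = - (LINT x:UNIV|lebesgue. D x $ i $ j * \<phi> x)"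
    by (simp add: set_lebesgue_integral_def)
qed

lemma sobolev_loc_lipschitz: "sobolev_loc p UNIV f D"
  unfolding sobolev_loc_def
  using L_loc_component L_loc_derivative weak_derivative_lipschitz by blast

end

section \<open>Lebesgue measure of linear images\<close>

text \<open>\<open>Transposition.transpose m n\<close> exchanges two indices and is not the
  transpose of a matrix.\<close>

lemma swap_matrix_vector_mult:
  "(\<chi> i j. mat 1 $ i $ Transposition.transpose m n j) *v x
    = (\<chi> i. (x::real^'n) $ Transposition.transpose m n i)"
proof -
  have "(\<Sum>j\<in>UNIV. (if i = Transposition.transpose m n j then 1 else 0) * x $ j)
      = x $ Transposition.transpose m n i" for i
  proof -
    have "i = Transposition.transpose m n j \<longleftrightarrow> j = Transposition.transpose m n i" for j
      by (metis transpose_involutory)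
    then show ?thesis by (simp add: if_distrib[of "\<lambda>u. u * _"] cong: if_cong)
  qed
  then show ?thesis by (simp add: vec_eq_iff matrix_vector_mult_def mat_def)
qed

text \<open>The image is the box with permuted corners, and permuting the side lengths leaves their
  product unchanged.\<close>

lemma measure_swap_cbox:
  fixes a b :: "real^'n"
  shows "measure lebesgue ((\<lambda>x. \<chi> i. x $ Transposition.transpose m n i) ` cbox a b) = measure lebesgue (cbox a b)"
proof -
  let ?h = "\<lambda>x::real^'n. \<chi> i. x $ Transposition.transpose m n i"
  have inv: "?h (?h x) = x" for x by (simp add: vec_eq_iff)
  have mem: "?h x \<in> cbox (?h a) (?h b)" if "x \<in> cbox a b" for x a b
    using that by (auto simp: mem_box_cart)
  have "?h ` cbox a b = cbox (?h a) (?h b)"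
  proof
    show "cbox (?h a) (?h b) \<subseteq> ?h ` cbox a b"
    proof
      fix y assume "y \<in> cbox (?h a) (?h b)"
      from mem[OF this] inv have "?h y \<in> cbox a b" by simp
      then show "y \<in> ?h ` cbox a b" by (metis inv image_eqI)
    qed
  qed (use mem in auto)
  moreover have "(\<Prod>i\<in>UNIV. b $ i - a $ i)
      = (\<Prod>i\<in>UNIV. b $ Transposition.transpose m n i - a $ Transposition.transpose m n i)"
    using prod.permute[OF permutes_swap_id, of m UNIV n "\<lambda>i. b $ i - a $ i"] by (simp add: o_def)
  moreover have "cbox (?h a) (?h b) = {} \<longleftrightarrow> cbox a b = {}"
    using calculation(1) by (metis image_is_empty)
  ultimately show ?thesis
    by (cases "cbox a b = {}") (simp_all add: content_cbox_cart)
qed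

lemma shear_matrix_vector_mult:
  assumes "m \<noteq> n"
  shows "(\<chi> i j. of_bool (i = m \<and> j = n \<or> i = j)) *v x
    = (\<chi> i. if i = m then x $ m + x $ n else (x::real^'n) $ i)"
proof -
  have "(\<Sum>j\<in>UNIV. of_bool (i = m \<and> j = n \<or> i = j) * x $ j) = (if i = m then x $ m + x $ n else x $ i)" for i
  proof -
    have "(\<Sum>j\<in>UNIV. of_bool (i = m \<and> j = n \<or> i = j) * x $ j)
        = (\<Sum>j\<in>UNIV. (if j = n then of_bool (i = m) * x $ j else 0) + (if j = i then x $ j else 0))"
      using assms by (intro sum.cong) auto
    also have "\<dots> = of_bool (i = m) * x $ n + x $ i"
      by (simp add: sum.distrib)
    finally show ?thesis by simp
  qed
  then show ?thesis by (simp add: vec_eq_iff matrix_vector_mult_def)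
qed

lemma det_shear_matrix:
  assumes "m \<noteq> n"
  shows "det (\<chi> i j. of_bool (i = m \<and> j = n \<or> i = j) :: real^'n^'n) = 1"
proof -
  have "(\<chi> i j. of_bool (i = m \<and> j = n \<or> i = j) :: real^'n^'n)
      = (\<chi> k. if k = m then row m (mat 1) + 1 *s row n (mat 1) else row k (mat 1))"
    using assms by (auto simp: vec_eq_iff row_def mat_def)
  then show ?thesis using det_row_operation[OF assms, of "mat 1 :: real^'n^'n" 1] by simp
qed

lemma measure_shear_cbox:
  fixes a b :: "real^'n" and E :: "real^'n^'n"
  assumes "m \<noteq> n" and E: "E = (\<chi> i j. of_bool (i = m \<and> j = n \<or> i = j))"
  shows "measure lebesgue ((*v) E ` cbox a b) = measure lebesgue (cbox a b)"
proof (cases "cbox a b = {}")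
  case False
  \<comment> \<open>Translation by \<open>v\<close> puts the lower corner at the origin, because
    \<open>measure_shear_interval\<close> asks for a nonnegative \<open>n\<close>-th coordinate
    there. The sheared box is then translated as well.\<close>
  define v :: "real^'n" where "v = (\<chi> i. - a $ i)"
  have "cbox a b = (+) (- v) ` cbox (v + a) (v + b)"
    by (simp add: cbox_translation image_image)
  then have "(*v) E ` cbox a b = (+) (E *v (- v)) ` (*v) E ` cbox (v + a) (v + b)"
    by (simp only: image_image matrix_vector_right_distrib)
  then have "measure lebesgue ((*v) E ` cbox a b) = measure lebesgue ((*v) E ` cbox (v + a) (v + b))"
    by (simp add: measure_translation)
  also have "\<dots> = measure lebesgue (cbox (v + a) (v + b))"
    using measure_shear_interval[OF assms(1), of "v + a" "v + b"] False
    unfolding E shear_matrix_vector_mult[OF assms(1)] by (simp add: v_def cbox_translation)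
  also have "\<dots> = measure lebesgue (cbox a b)"
    unfolding cbox_translation by (rule measure_translation)
  finally show ?thesis .
qed simp

text \<open>\<open>measure_linear_image\<close> of the library needs a well-ordered index type.\<close>

lemma measure_matrix_image:
  fixes A :: "real^'n^'n"
  assumes "S \<in> lmeasurable"
  shows "measure lebesgue ((*v) A ` S) = \<bar>det A\<bar> * measure lebesgue S"
proof -
  \<comment> \<open>The induction runs over a factorization into elementary matrices. Measurability
    of the images is part of \<open>P\<close> so that the product case can apply \<open>P A\<close>
    to the image under \<open>B\<close>.\<close>
  define P where "P A \<longleftrightarrow> (\<forall>S\<in>lmeasurable. (*v) A ` S \<in> lmeasurable \<and>
      measure lebesgue ((*v) A ` S) = \<bar>det A\<bar> * measure lebesgue S)" for A :: "real^'n^'n"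
  \<comment> \<open>For a linear map the scaling factor has to be verified on boxes only; this
    settles swaps and shears.\<close>
  have sufficient: "P A" if "\<And>a b. measure lebesgue ((*v) A ` cbox a b) = \<bar>det A\<bar> * measure lebesgue (cbox a b)" for A
    unfolding P_def using measure_linear_sufficient[OF matrix_vector_mul_linear _ that] by metis
  have "P A"
  proof (rule induct_matrix_elementary_alt)
    fix A B :: "real^'n^'n" assume "P A" "P B"
    moreover have "(*v) (A ** B) ` S = (*v) A ` (*v) B ` S" for S
      by (simp add: image_image matrix_vector_mul_assoc)
    ultimately show "P (A ** B)"
      by (simp only: P_def det_mul abs_mult) auto
  next
    fix A :: "real^'n^'n" and i assume row: "row i A = 0"
    then have "(A *v x) $ i = 0" for x
      by (simp add: matrix_vector_mul_component row_def)
    then have "negligible ((*v) A ` S)" for S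
      by (intro negligible_subset[OF negligible_standard_hyperplane_cart[of i]]) auto
    then show "P A"
      using det_zero_row(2)[OF row] by (simp add: P_def negligible_iff_measure)
  next
    fix A :: "real^'n^'n" assume diag: "\<And>i j. i \<noteq> j \<Longrightarrow> A $ i $ j = 0"
    have "(\<Sum>j\<in>UNIV. A $ i $ j * x $ j) = A $ i $ i * x $ i" for i and x :: "real^'n"
      by (subst sum.remove[of _ i]) (auto simp: diag intro!: sum.neutral)
    then have "(*v) A = (\<lambda>x. \<chi> i. A $ i $ i * x $ i)"
      by (auto simp: fun_eq_iff vec_eq_iff matrix_vector_mult_def)
    then show "P A"
      by (simp add: P_def measurable_stretch measure_stretch det_diagonal[OF diag])
  next
    fix m n :: 'n assume "m \<noteq> n"
    have "\<bar>det (\<chi> i j. mat 1 $ i $ Transposition.transpose m n j :: real^'n^'n)\<bar> = 1"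
      using det_permute_columns[OF permutes_swap_id[OF UNIV_I UNIV_I], where A = "mat 1 :: real^'n^'n"]
      by (simp add: sign_swap_id abs_mult)
    then show "P (\<chi> i j. mat 1 $ i $ Transposition.transpose m n j)"
      by (intro sufficient) (simp add: swap_matrix_vector_mult measure_swap_cbox)
  next
    fix m n :: 'n assume mn: "m \<noteq> n"
    show "P (\<chi> i j. of_bool (i = m \<and> j = n \<or> i = j))"
      by (rule sufficient)
        (simp only: measure_shear_cbox[OF mn refl] det_shear_matrix[OF mn] abs_one mult_1)
  qed
  then show ?thesis using assms by (simp add: P_def)
qed

section \<open>Radially varying linear maps\<close>

definition outer :: "real^'m \<Rightarrow> real^'n \<Rightarrow> real^'n^'m" where
  "outer u v = (\<chi> i j. u $ i * v $ j)"

lemma outer_vector_mult: "outer u v *v w = (v \<bullet> w) *\<^sub>R u"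
  by (simp add: outer_def matrix_vector_mult_def inner_vec_def vec_eq_iff sum_distrib_left mult_ac)

lemma norm_outer: "norm (outer u v) = norm u * norm v"
proof -
  have "outer u v $ i = u $ i *\<^sub>R v" for i
    by (simp add: outer_def vec_eq_iff)
  then show ?thesis
    by (simp add: norm_vec_def[of "outer u v"] norm_vec_def[of u] L2_set_left_distrib)
qed

text \<open>With \<open>s = a / b\<close> this is \<open>ln s \<le> s - 1\<close>. The weight
  \<open>b\<close> compensates the steepness of the logarithm near \<open>0\<close>, so that a twist
  is Lipschitz up to the origin.\<close>

lemma ln_diff_mult_le:
  fixes a b :: real
  assumes "0 < b" "b \<le> a"
  shows "\<bar>ln a - ln b\<bar> * b \<le> a - b"
proof -
  have "ln (a / b) \<le> a / b - 1" using assms by (intro ln_le_minus_one) auto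
  then show ?thesis using assms by (simp add: ln_div field_simps)
qed

text \<open>In the variable \<open>ln (norm x)\<close> a dilation by \<open>t\<close> becomes a
  shift by \<open>ln t\<close>, and on each sphere about \<open>0\<close> the map is linear. At the
  origin it is \<open>0\<close> whatever matrix \<open>ln 0\<close> selects.\<close>

definition twist :: "(real \<Rightarrow> real^'n^'n) \<Rightarrow> real^'n \<Rightarrow> real^'n" where
  "twist A x = A (ln (norm x)) *v x"

lemma twist_0 [simp]: "twist A 0 = 0"
  by (simp add: twist_def)

section \<open>Lipschitz bound, injectivity and derivative of a twist\<close>

context
  fixes A :: "real \<Rightarrow> real^'n^'n" and c C d :: real
  assumes A_nondeg: "\<And>u. A u \<in> nondeg c C"
    and A_lip: "\<And>u v. norm (A u - A v) \<le> d * \<bar>u - v\<bar>"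
begin

text \<open>With the matrix frozen at the larger radius, the error is
  \<open>(A (ln (norm x)) - A (ln (norm y))) *v y\<close>, which carries the smaller radius as its
  weight, just as \<open>ln_diff_mult_le\<close> demands.\<close>

lemma twist_linear_approx:
  assumes "norm y \<le> norm x"
  shows "norm (twist A x - twist A y - A (ln (norm x)) *v (x - y)) \<le> d * norm (x - y)"
proof (cases "y = 0")
  case True
  have "0 \<le> d" using order_trans[OF norm_ge_zero A_lip[of 1 0]] by simp
  then show ?thesis using True by (simp add: twist_def)
next
  case False
  have d: "0 \<le> d" using order_trans[OF norm_ge_zero A_lip[of 1 0]] by simp
  have "twist A x - twist A y - A (ln (norm x)) *v (x - y) = (A (ln (norm x)) - A (ln (norm y))) *v y"
    by (simp add: twist_def matrix_vector_mult_diff_rdistrib matrix_vector_mult_diff_distrib)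
  then have "norm (twist A x - twist A y - A (ln (norm x)) *v (x - y))
      \<le> norm (A (ln (norm x)) - A (ln (norm y))) * norm y"
    by (simp add: norm_matrix_vector_mult_le)
  also have "\<dots> \<le> (d * \<bar>ln (norm x) - ln (norm y)\<bar>) * norm y"
    by (intro mult_right_mono A_lip norm_ge_zero)
  also have "\<dots> = d * (\<bar>ln (norm x) - ln (norm y)\<bar> * norm y)" by simp
  also have "\<dots> \<le> d * (norm x - norm y)"
    using False assms by (intro mult_left_mono ln_diff_mult_le d) auto
  also have "\<dots> \<le> d * norm (x - y)"
    by (intro mult_left_mono norm_triangle_ineq2 d)
  finally show ?thesis .
qed

lemma twist_lipschitz: "norm (twist A x - twist A y) \<le> (C + d) * norm (x - y)"
proof -
  have *: "norm (twist A x - twist A y) \<le> (C + d) * norm (x - y)" if "norm y \<le> norm x" for x y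
  proof -
    have "norm (A (ln (norm x)) *v (x - y)) \<le> C * norm (x - y)"
      by (rule order_trans[OF norm_matrix_vector_mult_le])
        (intro mult_right_mono nondegD(2)[OF A_nondeg] norm_ge_zero)
    then show ?thesis
      using twist_linear_approx[OF that] norm_triangle_sub[of "twist A x - twist A y" "A (ln (norm x)) *v (x - y)"]
      by (simp add: distrib_right)
  qed
  show ?thesis
    using *[of x y] *[of y x] by (cases "norm y \<le> norm x") (auto simp: norm_minus_commute)
qed

lemma twist_continuous: "continuous_on S (twist A)"
proof (rule lipschitz_on_continuous_on)
  have "0 \<le> C + d"
    using order_trans[OF norm_ge_zero twist_lipschitz[of "axis undefined 1" 0]] by simp
  then show "(C + d)-lipschitz_on S (twist A)"
    using twist_lipschitz by (auto intro!: lipschitz_onI simp: dist_norm)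
qed

lemma twist_inj:
  assumes m: "\<And>B (v::real^'n). B \<in> nondeg c C \<Longrightarrow> norm (B *v v) \<ge> m * norm v" and "d < m"
  shows "inj (twist A)"
proof -
  have *: "x = y" if "twist A x = twist A y" "norm y \<le> norm x" for x y
  proof -
    have "m * norm (x - y) \<le> d * norm (x - y)"
      using m[OF A_nondeg, of "x - y" "ln (norm x)"] twist_linear_approx[OF that(2)] that(1) by simp
    then have "norm (x - y) \<le> 0" using \<open>d < m\<close> by (simp add: mult_le_cancel_right)
    then show ?thesis by simp
  qed
  show ?thesis
    by (rule injI) (metis * linear)
qed

text \<open>The varying matrix adds a rank-one term to the derivative; its norm is
  \<open>norm (A' *v x) / norm x\<close>, hence at most \<open>norm A'\<close> at every
  scale.\<close>

lemma twist_has_derivative: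
  assumes "x \<noteq> 0" "(A has_vector_derivative A') (at (ln (norm x)))"
  shows "(twist A has_derivative (\<lambda>v. (A (ln (norm x)) + outer (A' *v x) (x /\<^sub>R (norm x)\<^sup>2)) *v v)) (at x)"
proof -
  have "((\<lambda>x. ln (norm x)) has_derivative (\<lambda>v. (x \<bullet> v) / (norm x)\<^sup>2)) (at x)"
    by (rule has_derivative_eq_rhs[OF has_derivative_ln[OF _ has_derivative_norm[OF assms(1)]]])
      (use assms(1) in \<open>auto simp: fun_eq_iff sgn_div_norm power2_eq_square divide_inverse inner_commute\<close>)
  then have "((\<lambda>x. A (ln (norm x))) has_derivative (\<lambda>v. ((x \<bullet> v) / (norm x)\<^sup>2) *\<^sub>R A')) (at x)"
    by (rule has_derivative_compose) (use assms(2) in \<open>simp add: has_vector_derivative_def\<close>)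
  from has_derivative_matrix_vector_mult[OF this has_derivative_ident]
  show ?thesis
    unfolding twist_def
    by (simp add: matrix_vector_mult_add_rdistrib outer_vector_mult scaleR_matrix_vector_assoc[symmetric]
        divide_inverse mult.commute)
qed

end

text \<open>The derivative is within \<open>d\<close> of a matrix in \<open>nondeg c C\<close>, so
  for small \<open>d\<close> its determinant is at least \<open>c/2\<close> and its norm at most
  \<open>C + d\<close>, which bounds the distortion. That \<open>d\<close> is fixed before
  \<open>A\<close> allows the path to be built afterwards with steps as short as
  \<open>d\<close>.\<close>

lemma quasiconformal_twist:
  assumes "0 < c"
  obtains d where "0 < d"
    "\<And>(A :: real \<Rightarrow> real^'n^'n) A' E. (\<And>u. A u \<in> nondeg c C) \<Longrightarrow>
      (\<And>u v. norm (A u - A v) \<le> d * \<bar>u - v\<bar>) \<Longrightarrow> countable E \<Longrightarrow>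
      (\<And>u. u \<notin> E \<Longrightarrow> (A has_vector_derivative A' u) (at u)) \<Longrightarrow>
      (\<And>u. u \<notin> E \<Longrightarrow> norm (A' u) \<le> d) \<Longrightarrow> quasiconformal UNIV (twist A) \<and> inj (twist A)"
proof -
  obtain m where m: "m > 0" "\<And>A (v::real^'n). A \<in> nondeg c C \<Longrightarrow> norm (A *v v) \<ge> m * norm v"
    using nondeg_lower_bound[OF assms, where 'n='n and C=C] by metis
  obtain d0 where d0: "d0 > 0"
      "\<And>A B :: real^'n^'n. A \<in> nondeg c C \<Longrightarrow> dist B A < d0 \<Longrightarrow> det B \<ge> c/2"
    using nondeg_perturb[of "c/2" c, where 'n='n and C=C] assms by auto
  \<comment> \<open>\<open>d < m\<close> serves injectivity, and \<open>d < d0\<close> keeps the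
    determinant of the derivative above \<open>c/2\<close>.\<close>
  define d where "d = min (m/2) (d0/2)"
  have d: "0 < d" "d < m" "d < d0" using m(1) d0(1) by (auto simp: d_def)
  show thesis
  proof (rule that[OF d(1)])
    fix A :: "real \<Rightarrow> real^'n^'n" and A' E
    assume A: "\<And>u. A u \<in> nondeg c C" and lip: "\<And>u v. norm (A u - A v) \<le> d * \<bar>u - v\<bar>"
      and E: "countable E" and deriv: "\<And>u. u \<notin> E \<Longrightarrow> (A has_vector_derivative A' u) (at u)"
      and A'_le: "\<And>u. u \<notin> E \<Longrightarrow> norm (A' u) \<le> d"
    \<comment> \<open>The exceptional set consists of the origin and countably many spheres, of
      radius \<open>exp u\<close> with \<open>u \<in> E\<close>.\<close>
    define N where "N = insert (0::real^'n) {x. ln (norm x) \<in> E}"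
    have "N \<subseteq> \<Union>(insert {0} ((\<lambda>u. sphere 0 (exp u)) ` E))"
    proof
      fix x assume "x \<in> N"
      then consider "x = 0" | "x \<noteq> 0" "ln (norm x) \<in> E" by (auto simp: N_def)
      then show "x \<in> \<Union>(insert {0} ((\<lambda>u. sphere 0 (exp u)) ` E))"
      proof cases
        case 2
        then have "x \<in> sphere 0 (exp (ln (norm x)))" by simp
        then show ?thesis using 2 by blast
      qed simp
    qed
    moreover have "negligible (\<Union>(insert {0::real^'n} ((\<lambda>u. sphere 0 (exp u)) ` E)))"
      using E by (intro negligible_countable_Union) (auto simp: negligible_sphere)
    ultimately have "negligible N" using negligible_subset by blast
    then have null: "N \<in> null_sets lebesgue" by (simp add: negligible_iff_null_sets)
    define D where "D x = (if x \<in> N then 0 else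
        A (ln (norm x)) + outer (A' (ln (norm x)) *v x) (x /\<^sub>R (norm x)\<^sup>2))" for x
    have "(twist A has_derivative (\<lambda>v. D x *v v)) (at x)" if "x \<notin> N" for x
    proof -
      have "x \<noteq> 0" "ln (norm x) \<notin> E" using that by (auto simp: N_def)
      from twist_has_derivative[OF A lip this(1) deriv[OF this(2)]] that show ?thesis
        by (simp add: D_def)
    qed
    then have sob: "sobolev_loc p UNIV (twist A) D" for p
      by (intro sobolev_loc_lipschitz[OF twist_lipschitz[OF A lip] null]) (auto simp: D_def)
    have DA: "norm (D x - A (ln (norm x))) \<le> d" if "x \<notin> N" for x
    proof -
      have x: "x \<noteq> 0" "ln (norm x) \<notin> E" using that by (auto simp: N_def)
      have "norm (D x - A (ln (norm x))) = norm (A' (ln (norm x)) *v x) / norm x"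
        using that x(1) by (simp add: D_def norm_outer power2_eq_square field_simps)
      also have "\<dots> \<le> (norm (A' (ln (norm x))) * norm x) / norm x"
        by (intro divide_right_mono norm_matrix_vector_mult_le norm_ge_zero)
      also have "\<dots> \<le> d" using x A'_le by simp
      finally show ?thesis .
    qed
    \<comment> \<open>The largest possible power of the norm over the smallest possible determinant,
      raised to 1 because quasiregularity asks for \<open>K \<ge> 1\<close>.\<close>
    define K where "K = max 1 ((C + d) ^ CARD('n) / (c / 2))"
    have "onorm (\<lambda>v. D x *v v) ^ CARD('n) \<le> K * det (D x)" if "x \<notin> N" for x
    proof -
      have det: "det (D x) \<ge> c / 2"
        using d0(2)[OF A, of "D x" "ln (norm x)"] DA[OF that] d(3) by (simp add: dist_norm)
      have "norm (D x) \<le> C + d"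
        using norm_triangle_sub[of "D x" "A (ln (norm x))"] DA[OF that] nondegD(2)[OF A, of "ln (norm x)"] by linarith
      moreover have "onorm (\<lambda>v. D x *v v) \<le> norm (D x)"
        by (intro onorm_le norm_matrix_vector_mult_le)
      ultimately have "onorm (\<lambda>v. D x *v v) ^ CARD('n) \<le> (C + d) ^ CARD('n)"
        by (intro power_mono onorm_pos_le matrix_vector_mul_bounded_linear) linarith
      also have "\<dots> = (C + d) ^ CARD('n) / (c / 2) * (c / 2)" using assms by simp
      also have "\<dots> \<le> K * (c / 2)" using assms by (intro mult_right_mono) (auto simp: K_def)
      also have "\<dots> \<le> K * det (D x)" using det by (intro mult_left_mono) (auto simp: K_def)
      finally show ?thesis .
    qed
    then have "AE x in lebesgue. x \<in> UNIV \<longrightarrow> onorm (\<lambda>v. D x *v v) ^ CARD('n) \<le> K * det (D x)"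
      by (intro AE_I'[OF null]) auto
    moreover have "K \<ge> 1" by (simp add: K_def)
    moreover have "inj (twist A)" by (rule twist_inj[OF A lip m(2) d(2)])
    ultimately show "quasiconformal UNIV (twist A) \<and> inj (twist A)"
      unfolding quasiconformal_def quasiregular_def
      using sob twist_continuous[OF A lip] by auto
  qed
qed

text \<open>By symmetry one inclusion suffices. If the connected image under \<open>f\<close> left
  the open image under \<open>g\<close>, which it meets at \<open>f a = g a\<close>, it would hit
  the frontier of the latter; that frontier lies in the common image of the sphere, which an
  injective \<open>f\<close> does not reach from the open ball.\<close>

lemma injective_image_ball_eq:
  fixes f g :: "'a::euclidean_space \<Rightarrow> 'a"
  assumes f: "continuous_on UNIV f" "inj f" and g: "continuous_on UNIV g" "inj g"
    and eq: "\<And>x. x \<in> sphere a r \<Longrightarrow> f x = g x" "f a = g a" and "0 < r"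
  shows "f ` ball a r = g ` ball a r"
proof -
  have "f ` ball a r \<subseteq> g ` ball a r"
    if f: "continuous_on UNIV f" "inj f" and g: "continuous_on UNIV g" "inj g"
      and eq: "\<And>x. x \<in> sphere a r \<Longrightarrow> f x = g x" "f a = g a" for f g :: "'a \<Rightarrow> 'a"
  proof (rule ccontr)
    assume "\<not> f ` ball a r \<subseteq> g ` ball a r"
    moreover have "connected (f ` ball a r)"
      by (intro connected_continuous_image continuous_on_subset[OF f(1)]) auto
    moreover have "f a \<in> f ` ball a r \<inter> g ` ball a r"
      using \<open>0 < r\<close> eq(2) by (metis IntI centre_in_ball image_eqI)
    ultimately have "f ` ball a r \<inter> frontier (g ` ball a r) \<noteq> {}"
      by (intro connected_Int_frontier) auto
    moreover have "frontier (g ` ball a r) \<subseteq> f ` sphere a r"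
    proof -
      have "compact (g ` cball a r)"
        by (intro compact_continuous_image continuous_on_subset[OF g(1)]) auto
      then have "closure (g ` ball a r) \<subseteq> g ` cball a r"
        by (intro closure_minimal image_mono compact_imp_closed) auto
      moreover have "open (g ` ball a r)"
        by (intro invariance_of_domain_gen continuous_on_subset[OF g(1)] inj_on_subset[OF g(2)]) auto
      moreover have "g ` cball a r \<subseteq> g ` ball a r \<union> g ` sphere a r" by force
      moreover have "g ` sphere a r = f ` sphere a r" using eq(1) by (metis image_cong)
      ultimately show ?thesis unfolding frontier_def interior_open[OF \<open>open (g ` ball a r)\<close>] by blast
    qed
    moreover have "f ` ball a r \<inter> f ` sphere a r = {}"
      using f(2) by (fastforce dest: injD)
    ultimately show False by blast
  qed
  from this[OF f g] this[OF g f] eq show ?thesis by (metis subset_antisym)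
qed

text \<open>On the sphere of radius \<open>r\<close> the twist agrees with \<open>A (ln r)\<close>,
  so both have the same image of the ball, whose volume is that of a linear image.\<close>

lemma mean_radius_twist:
  fixes A :: "real \<Rightarrow> real^'n^'n"
  assumes "continuous_on UNIV (twist A)" "inj (twist A)" "0 < det (A (ln r))" "0 < r"
  shows "mean_radius (twist A) 0 r = r * det (A (ln r)) powr (1 / CARD('n))"
proof -
  let ?G = "(*v) (A (ln r))"
  have "twist A ` ball 0 r = ?G ` ball 0 r"
  proof (rule injective_image_ball_eq)
    show "inj ?G" using assms(3) by (intro inj_matrix_vector_mult) (simp add: invertible_det_nz)
    show "continuous_on UNIV ?G" by (rule matrix_vector_mult_linear_continuous_on)
  qed (use assms in \<open>auto simp: twist_def\<close>)
  then have "measure lebesgue (twist A ` ball 0 r) = det (A (ln r)) * measure lebesgue (ball (0::real^'n) r)"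
    using measure_matrix_image[of "ball 0 r" "A (ln r)"] assms(3) by simp
  also have "measure lebesgue (ball (0::real^'n) r) = r ^ CARD('n) * measure lebesgue (ball (0::real^'n) 1)"
    using content_ball_conv_unit_ball[of r "0::real^'n"] assms(4) by simp
  finally have "mean_radius (twist A) 0 r = (det (A (ln r)) * r ^ CARD('n)) powr (1 / CARD('n))"
    using content_ball_pos[of 1 "0::real^'n"] unfolding mean_radius_def by (simp add: field_simps)
  also have "\<dots> = r * det (A (ln r)) powr (1 / CARD('n))"
    using assms(3,4) by (simp add: powr_mult powr_powr flip: powr_realpow)
  finally show ?thesis .
qed

section \<open>Infinitesimal spaces of twisted maps\<close>

text \<open>The piecewise linear path that is at \<open>G k\<close> at time \<open>k\<close>. For
  negative \<open>s\<close>, where \<open>nat\<close> cuts the floor off at \<open>0\<close>, it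
  prolongs the first segment.\<close>

definition polygonal :: "(nat \<Rightarrow> 'a::real_vector) \<Rightarrow> real \<Rightarrow> 'a" where
  "polygonal G s = G (nat \<lfloor>s\<rfloor>) + (s - real (nat \<lfloor>s\<rfloor>)) *\<^sub>R (G (Suc (nat \<lfloor>s\<rfloor>)) - G (nat \<lfloor>s\<rfloor>))"

lemma polygonal_on_segment:
  assumes "real k \<le> s" "s \<le> real (Suc k)"
  shows "polygonal G s = G k + (s - real k) *\<^sub>R (G (Suc k) - G k)"
proof (cases "s = real (Suc k)")
  case True
  then have "nat \<lfloor>s\<rfloor> = Suc k" by simp
  then show ?thesis using True by (simp add: polygonal_def)
next
  case False
  with assms have "\<lfloor>s\<rfloor> = int k" by (intro floor_unique) auto
  then show ?thesis by (simp add: polygonal_def)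
qed

lemma polygonal_of_nat [simp]: "polygonal G (real k) = G k"
  by (simp add: polygonal_def)

lemma norm_polygonal_diff_node:
  fixes G :: "nat \<Rightarrow> 'a::real_normed_vector"
  assumes "0 \<le> s"
  shows "norm (polygonal G s - G (nat \<lfloor>s\<rfloor>)) \<le> norm (G (Suc (nat \<lfloor>s\<rfloor>)) - G (nat \<lfloor>s\<rfloor>))"
proof -
  have "\<bar>s - real (nat \<lfloor>s\<rfloor>)\<bar> \<le> 1"
    using assms of_int_floor_le[of s] floor_correct[of s] by (simp add: abs_le_iff) linarith
  then show ?thesis by (simp add: polygonal_def mult_left_le_one_le)
qed

text \<open>Segments are glued one by one. The starting index \<open>N\<close> allows both a global
  bound and a much better one far along the path, where the steps are short.\<close>

lemma polygonal_lipschitz: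
  fixes G :: "nat \<Rightarrow> 'a::real_normed_vector"
  assumes d: "\<And>k. N \<le> k \<Longrightarrow> norm (G (Suc k) - G k) \<le> d" and "0 \<le> d"
    and st: "real N \<le> s" "real N \<le> t"
  shows "norm (polygonal G s - polygonal G t) \<le> d * \<bar>s - t\<bar>"
proof -
  have "d-lipschitz_on {real N..real (N + j)} (polygonal G)" for j
  proof (induction j)
    case 0
    show ?case using \<open>0 \<le> d\<close> by (intro lipschitz_onI) auto
  next
    case (Suc j)
    let ?k = "N + j"
    have "d-lipschitz_on {real ?k..real (Suc ?k)} (polygonal G)"
    proof (rule lipschitz_onI)
      fix x y assume "x \<in> {real ?k..real (Suc ?k)}" "y \<in> {real ?k..real (Suc ?k)}"
      then have "polygonal G x - polygonal G y = (x - y) *\<^sub>R (G (Suc ?k) - G ?k)"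
        by (auto simp: polygonal_on_segment[of ?k] simp flip: scaleR_diff_left)
      then show "dist (polygonal G x) (polygonal G y) \<le> d * dist x y"
        using mult_left_mono[OF d[of ?k], of "\<bar>x - y\<bar>"] by (simp add: dist_norm mult.commute)
    qed (rule \<open>0 \<le> d\<close>)
    from lipschitz_on_concat[OF Suc.IH this refl] show ?case by simp
  qed
  note lip = this
  obtain j where "max s t \<le> real j" using real_arch_simple by blast
  then have "s \<in> {real N..real (N + j)}" "t \<in> {real N..real (N + j)}" using st by auto
  from lipschitz_onD[OF lip this] show ?thesis by (simp add: dist_norm)
qed

text \<open>Off the integers \<open>\<bar>u\<bar>\<close> is inside a unit interval on which the
  path is affine; since \<open>0\<close> is an integer, the corner of the absolute value is excluded
  as well.\<close>

lemma polygonal_abs_has_vector_derivative: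
  fixes G :: "nat \<Rightarrow> 'a::real_normed_vector"
  assumes "u \<notin> \<int>"
  shows "((\<lambda>u. polygonal G \<bar>u\<bar>) has_vector_derivative
    sgn u *\<^sub>R (G (Suc (nat \<lfloor>\<bar>u\<bar>\<rfloor>)) - G (nat \<lfloor>\<bar>u\<bar>\<rfloor>))) (at u)"
proof -
  define k where "k = nat \<lfloor>\<bar>u\<bar>\<rfloor>"
  have "u \<noteq> 0" using assms by auto
  have "\<bar>u\<bar> \<notin> \<int>" using assms by (auto simp: abs_if split: if_splits)
  then have "real k \<noteq> \<bar>u\<bar>" by (metis Ints_of_nat)
  moreover have "real k = of_int \<lfloor>\<bar>u\<bar>\<rfloor>" by (simp add: k_def)
  then have "real k \<le> \<bar>u\<bar>" "\<bar>u\<bar> < real (Suc k)" by linarith+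
  ultimately have u: "u \<in> {u. real k < \<bar>u\<bar>} \<inter> {u. \<bar>u\<bar> < real (Suc k)}" by auto
  have "(abs has_real_derivative sgn u) (at u)"
  proof -
    have "norm = (abs :: real \<Rightarrow> real)" "(\<lambda>h. h \<bullet> sgn u) = (*) (sgn u)" by (auto simp: fun_eq_iff)
    with has_derivative_norm[OF \<open>u \<noteq> 0\<close>] show ?thesis by (simp only: has_field_derivative_def)
  qed
  then have "((\<lambda>u. G k + (\<bar>u\<bar> - real k) *\<^sub>R (G (Suc k) - G k)) has_vector_derivative
      sgn u *\<^sub>R (G (Suc k) - G k)) (at u)"
    by (auto intro!: derivative_eq_intros simp: has_real_derivative_iff_has_vector_derivative[symmetric])
  then show ?thesis
    unfolding k_def[symmetric]
  proof (rule has_vector_derivative_transform_within_open[OF _ _ u])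
    show "open ({u. real k < \<bar>u\<bar>} \<inter> {u. \<bar>u\<bar> < real (Suc k)})"
      by (intro open_Int open_Collect_less continuous_intros)
  qed (auto simp: polygonal_on_segment[of k])
qed

text \<open>The value at \<open>e\<close> of \<open>A\<close> scaled to determinant 1; such scaled
  matrices are the generalized derivatives of a twist.\<close>

definition normalized_image :: "real^'n \<Rightarrow> real^'n^'n \<Rightarrow> real^'n" where
  "normalized_image e A = (A *v e) /\<^sub>R (det A powr (1 / CARD('n)))"

lemma normalized_image_continuous:
  assumes "0 < c"
  shows "continuous_on (nondeg c C) (normalized_image e)"
  unfolding normalized_image_def[abs_def]
  by (intro continuous_intros) (use assms in \<open>auto dest!: nondegD(1)\<close>)

lemma filterlim_abs_ln_nat_floor:
  fixes t :: "nat \<Rightarrow> real"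
  assumes "t \<longlonglongrightarrow> 0" "\<And>k. 0 < t k"
  shows "filterlim (\<lambda>k. nat \<lfloor>\<bar>ln (t k)\<bar>\<rfloor>) sequentially sequentially"
proof -
  have "\<forall>\<^sub>F k in sequentially. t k \<in> {0<..} \<and> t k \<noteq> 0"
    by (intro always_eventually allI) (use assms(2) in \<open>metis greaterThan_iff less_irrefl\<close>)
  then have "filterlim t (at_right 0) sequentially"
    using assms(1) by (simp only: filterlim_at simp_thms)
  then have "filterlim (\<lambda>k. ln (t k)) at_bot sequentially"
    by (rule filterlim_compose[OF ln_at_0])
  then have "filterlim (\<lambda>k. \<bar>ln (t k)\<bar>) at_top sequentially"
    by (rule filterlim_at_infinity_imp_norm_at_top[OF filterlim_at_bot_imp_at_infinity, unfolded real_norm_def])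
  then show ?thesis
    by (intro filterlim_compose[OF filterlim_nat_sequentially] filterlim_compose[OF filterlim_floor_sequentially])
qed

text \<open>The factor \<open>a\<close> tames the logarithm at \<open>0\<close>. This keeps the
  effect of the shift by \<open>ln (norm x)\<close> bounded on bounded sets, the origin
  included.\<close>

lemma abs_ln_mult_le:
  fixes a R :: real
  assumes "0 < a" "a \<le> R"
  shows "\<bar>ln a\<bar> * a \<le> 1 + R\<^sup>2"
proof (cases "1 \<le> a")
  case True
  have "ln a \<le> a" using ln_le_minus_one[OF assms(1)] by simp
  then have "ln a * a \<le> a * a" using assms(1) by (intro mult_right_mono) auto
  also have "\<dots> \<le> R * R" using assms by (intro mult_mono) auto
  finally show ?thesis using True by (simp add: power2_eq_square)
next
  case False
  have "ln (inverse a) \<le> inverse a - 1" using assms(1) by (intro ln_le_minus_one) auto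
  then have "- ln a * a \<le> (inverse a - 1) * a" using assms(1) by (intro mult_right_mono) (auto simp: ln_inverse)
  also have "\<dots> \<le> 1" using assms(1) by (simp add: field_simps)
  also have "\<dots> \<le> 1 + R\<^sup>2" by simp
  finally show ?thesis using False assms(1) by (simp add: abs_if)
qed

section \<open>Generalized derivatives of a twist along a polygonal path\<close>

context
  fixes G :: "nat \<Rightarrow> real^'n^'n" and A :: "real \<Rightarrow> real^'n^'n" and c C :: real
    and X :: "(real^'n) set" and e :: "real^'n"
  defines "A \<equiv> \<lambda>u. polygonal G \<bar>u\<bar>"
  assumes c: "0 < c" and nd: "\<And>u. A u \<in> nondeg c C"
    and step: "(\<lambda>k. G (Suc k) - G k) \<longlonglongrightarrow> 0"
    and cont: "continuous_on UNIV (twist A)" and inj: "inj (twist A)"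
begin

lemma polygonal_nodes_nondeg: "G k \<in> nondeg c C"
  using nd[of "real k"] by (simp add: A_def)

text \<open>The dilation shifts the argument of \<open>A\<close> by \<open>ln t\<close>, and its
  factor \<open>t\<close> cancels against the one in the mean radius.\<close>

lemma rescaling_twist:
  assumes "0 < t"
  shows "rescaling (twist A) 0 t x = (A (ln t + ln (norm x)) *v x) /\<^sub>R (det (A (ln t)) powr (1 / CARD('n)))"
proof (cases "x = 0")
  case False
  have "det (A (ln t)) > 0" using nondegD(1)[OF nd[of "ln t"]] c by linarith
  then show ?thesis
    using assms False
    by (simp add: rescaling_def mean_radius_twist[OF cont inj] twist_def ln_mult matrix_vector_mult_scaleR)
qed (simp add: rescaling_def)

lemma rescaling_twist_unit:
  assumes "0 < t" "norm e = 1"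
  shows "rescaling (twist A) 0 t e = normalized_image e (A (ln t))"
  using rescaling_twist[OF assms(1), of e] assms(2) by (simp add: normalized_image_def)

text \<open>As \<open>t k\<close> tends to \<open>0\<close>, the matrices
  \<open>A (ln (t k))\<close> lie on ever later and ever shorter segments. Their normalized values
  therefore have the same limit as those of the nodes, which belong to the closed set
  \<open>X\<close>.\<close>

lemma generalized_derivative_value_mem:
  assumes "generalized_derivative (twist A) 0 \<phi>" "norm e = 1"
    and "closed X" and val: "\<And>k. normalized_image e (G k) \<in> X"
  shows "\<phi> e \<in> X"
proof -
  obtain t where t: "\<And>k::nat. t k > 0" "t \<longlonglongrightarrow> 0"
    and lim: "locally_uniform_limit (\<lambda>k. rescaling (twist A) 0 (t k)) \<phi>"
    using assms(1) by (auto simp: generalized_derivative_def)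
  obtain r where r: "r > 0" "uniform_limit (ball e r) (\<lambda>k. rescaling (twist A) 0 (t k)) \<phi> sequentially"
    using lim by (auto simp: locally_uniform_limit_def)
  have "(\<lambda>k. rescaling (twist A) 0 (t k) e) \<longlonglongrightarrow> \<phi> e"
    by (rule tendsto_uniform_limitI[OF r(2)]) (use r(1) in simp)
  then have 1: "(\<lambda>k. normalized_image e (A (ln (t k)))) \<longlonglongrightarrow> \<phi> e"
    by (simp add: rescaling_twist_unit[OF t(1) assms(2)])
  \<comment> \<open>The index of the node at which the segment through time
    \<open>\<bar>ln (t k)\<bar>\<close> starts.\<close>
  define m where "m k = nat \<lfloor>\<bar>ln (t k)\<bar>\<rfloor>" for k
  have "filterlim m sequentially sequentially"
    using filterlim_abs_ln_nat_floor[OF t(2,1)] by (simp add: m_def[abs_def])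
  from filterlim_compose[OF step this] have "(\<lambda>k. norm (G (Suc (m k)) - G (m k))) \<longlonglongrightarrow> 0"
    by (rule tendsto_norm_zero)
  then have dist: "(\<lambda>k. dist (A (ln (t k))) (G (m k))) \<longlonglongrightarrow> 0"
    by (rule Lim_null_comparison[rotated])
      (auto simp: A_def m_def dist_norm norm_polygonal_diff_node intro!: always_eventually)
  \<comment> \<open>Both sequences of matrices move, so their closeness passes to the images by
    uniform continuity.\<close>
  have unif: "uniformly_continuous_on (nondeg c C) (normalized_image e)"
    by (intro compact_uniformly_continuous normalized_image_continuous c compact_nondeg)
  have "(\<lambda>k. dist (normalized_image e (A (ln (t k)))) (normalized_image e (G (m k)))) \<longlonglongrightarrow> 0"
    using unif[unfolded uniformly_continuous_on_sequentially, rule_format,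
        of "\<lambda>k. A (ln (t k))" "\<lambda>k. G (m k)"] dist nd polygonal_nodes_nondeg by simp
  then have "(\<lambda>k. normalized_image e (G (m k))) \<longlonglongrightarrow> \<phi> e"
    by (intro Lim_transform2[OF 1]) (simp add: dist_norm tendsto_norm_zero_iff)
  then show ?thesis
    by (rule closed_sequentially[OF assms(3) val])
qed

text \<open>The radii \<open>exp (- real (s j))\<close> make \<open>A (ln t)\<close> a node. On a
  bounded set the further shift by \<open>ln (norm x)\<close> changes the value little, since the
  steps far along the path are short, and the nodes converge to \<open>B\<close>.\<close>

lemma generalized_derivative_along_nodes:
  assumes s: "strict_mono s" and lim: "(\<lambda>j. G (s j)) \<longlonglongrightarrow> B" and B: "B \<in> nondeg c C"
  shows "generalized_derivative (twist A) 0 (\<lambda>x. (B *v x) /\<^sub>R (det B powr (1 / CARD('n))))"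
proof -
  define t where "t j = exp (- real (s j))" for j
  define \<mu> where "\<mu> M = det M powr (1 / CARD('n))" for M :: "real^'n^'n"
  have \<mu>: "\<mu> M \<ge> c powr (1 / CARD('n))" if "M \<in> nondeg c C" for M
    using nondegD(1)[OF that] c unfolding \<mu>_def by (intro powr_mono2) auto
  have c': "c powr (1 / CARD('n)) > 0" using c by simp
  have "(\<lambda>j. G (s j) /\<^sub>R \<mu> (G (s j))) \<longlonglongrightarrow> B /\<^sub>R \<mu> B"
  proof -
    have "continuous_on (nondeg c C) (\<lambda>M::real^'n^'n. M /\<^sub>R \<mu> M)"
      unfolding \<mu>_def by (intro continuous_intros) (use c in \<open>auto dest!: nondegD(1)\<close>)
    from continuous_on_tendsto_compose[OF this lim B] show ?thesis
      by (simp add: polygonal_nodes_nondeg)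
  qed
  then have lim': "(\<lambda>j. norm (G (s j) /\<^sub>R \<mu> (G (s j)) - B /\<^sub>R \<mu> B)) \<longlonglongrightarrow> 0"
    by (intro tendsto_norm_zero LIM_zero)
  have "uniform_limit (ball x0 1) (\<lambda>j. rescaling (twist A) 0 (t j)) (\<lambda>x. (B *v x) /\<^sub>R \<mu> B) sequentially" for x0
  proof (rule uniform_limitI)
    fix \<epsilon> :: real assume "0 < \<epsilon>"
    define R where "R = norm x0 + 1"
    have "R \<ge> 1" by (simp add: R_def)
    \<comment> \<open>Chosen so that \<open>\<delta> * (1 + R\<^sup>2)\<close>, divided by the lower
      bound \<open>c powr (1 / CARD('n))\<close> for \<open>\<mu>\<close>, is
      \<open>\<epsilon> / 2\<close>. The other half is spent on the convergence of the
      nodes.\<close>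
    define \<delta> where "\<delta> = \<epsilon> * c powr (1 / CARD('n)) / (2 * (1 + R\<^sup>2))"
    have R2: "1 + R\<^sup>2 > 0" by (simp add: add_pos_nonneg)
    have aux: "\<epsilon> * p / (2 * w) * w / p = \<epsilon> / 2" if "0 < p" "0 < w" for p w :: real
      using that by simp
    from R2 have "\<delta> > 0" using \<open>0 < \<epsilon>\<close> c' by (simp add: \<delta>_def)
    then obtain N where N: "\<And>k. N \<le> k \<Longrightarrow> norm (G (Suc k) - G k) < \<delta>"
      using LIMSEQ_D[OF step] by (metis diff_zero)
    have "\<forall>\<^sub>F j in sequentially. real (s j) \<ge> real N + R"
      using filterlim_compose[OF filterlim_real_sequentially filterlim_subseq[OF s]]
      by (simp add: filterlim_at_top)
    moreover have "\<forall>\<^sub>F j in sequentially. norm (G (s j) /\<^sub>R \<mu> (G (s j)) - B /\<^sub>R \<mu> B) < \<epsilon> / (2 * R)"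
      using order_tendstoD(2)[OF lim', of "\<epsilon> / (2 * R)"] \<open>0 < \<epsilon>\<close> \<open>R \<ge> 1\<close> by auto
    ultimately show "\<forall>\<^sub>F j in sequentially. \<forall>x\<in>ball x0 1.
        dist (rescaling (twist A) 0 (t j) x) ((B *v x) /\<^sub>R \<mu> B) < \<epsilon>"
    proof eventually_elim
      case (elim j)
      let ?M = "G (s j)"
      have "0 < \<mu> ?M" using \<mu>[OF polygonal_nodes_nondeg, of "s j"] c' by linarith
      then have scale: "norm (v /\<^sub>R \<mu> ?M) = norm v / \<mu> ?M" for v :: "real^'n"
        by (simp add: divide_inverse mult.commute)
      have At: "A (ln (t j)) = ?M" by (simp add: t_def A_def)
      show ?case
      proof
        fix x assume "x \<in> ball x0 1"
        then have xR: "norm x \<le> R"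
          using norm_triangle_sub[of x x0] by (simp add: R_def dist_norm norm_minus_commute)
        have "norm ((A (ln (t j) + ln (norm x)) - ?M) *v x) \<le> \<delta> * (1 + R\<^sup>2)"
        proof (cases "x = 0")
          case False
          \<comment> \<open>An upper bound is enough: a small \<open>norm x\<close> moves the
            argument further towards \<open>-\<infinity>\<close>. With the margin \<open>R\<close>
            in the choice of \<open>j\<close>, both arguments have absolute value at least
            \<open>N\<close>.\<close>
          have "ln (norm x) \<le> R" using ln_le_minus_one[of "norm x"] False xR by simp
          then have "ln (t j) + ln (norm x) \<le> - real N" using elim(1) by (simp add: t_def)
          then have "norm (A (ln (t j) + ln (norm x)) - A (ln (t j))) \<le>
              \<delta> * \<bar>\<bar>ln (t j) + ln (norm x)\<bar> - \<bar>ln (t j)\<bar>\<bar>"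
            unfolding A_def using N \<open>\<delta> > 0\<close> elim(1) \<open>R \<ge> 1\<close>
            by (intro polygonal_lipschitz[of N]) (auto simp: t_def less_imp_le)
          also have "\<dots> \<le> \<delta> * \<bar>ln (norm x)\<bar>"
            using \<open>\<delta> > 0\<close> by (intro mult_left_mono) auto
          finally have "norm (A (ln (t j) + ln (norm x)) - ?M) * norm x \<le> \<delta> * \<bar>ln (norm x)\<bar> * norm x"
            unfolding At by (rule mult_right_mono) simp
          also have "\<dots> \<le> \<delta> * (1 + R\<^sup>2)"
            using abs_ln_mult_le[of "norm x" R] False xR \<open>\<delta> > 0\<close> by (simp add: mult.assoc)
          finally show ?thesis by (rule order_trans[OF norm_matrix_vector_mult_le])
        qed (use \<open>\<delta> > 0\<close> R2 in simp)
        then have "norm ((A (ln (t j) + ln (norm x)) - ?M) *v x) / \<mu> ?M \<le> \<delta> * (1 + R\<^sup>2) / c powr (1 / CARD('n))"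
          using \<mu>[OF polygonal_nodes_nondeg, of "s j"] c' \<open>\<delta> > 0\<close> R2 by (intro frac_le) auto
        also have "\<dots> = \<epsilon> / 2" unfolding \<delta>_def by (rule aux[OF c' R2])
        finally have 1: "norm (((A (ln (t j) + ln (norm x)) - ?M) *v x) /\<^sub>R \<mu> ?M) \<le> \<epsilon> / 2"
          unfolding scale .
        have "norm ((?M /\<^sub>R \<mu> ?M - B /\<^sub>R \<mu> B) *v x) \<le> norm (?M /\<^sub>R \<mu> ?M - B /\<^sub>R \<mu> B) * R"
          by (rule order_trans[OF norm_matrix_vector_mult_le]) (use xR in \<open>auto intro: mult_left_mono\<close>)
        also have "\<dots> < \<epsilon> / (2 * R) * R"
          using elim(2) \<open>R \<ge> 1\<close> by (intro mult_strict_right_mono) auto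
        also have "\<dots> = \<epsilon> / 2" using \<open>R \<ge> 1\<close> by simp
        finally have 2: "norm ((?M /\<^sub>R \<mu> ?M - B /\<^sub>R \<mu> B) *v x) < \<epsilon> / 2" .
        have "rescaling (twist A) 0 (t j) x = (A (ln (t j) + ln (norm x)) *v x) /\<^sub>R \<mu> ?M"
          using rescaling_twist[of "t j" x] At by (simp add: \<mu>_def t_def)
        then have "rescaling (twist A) 0 (t j) x - (B *v x) /\<^sub>R \<mu> B
            = ((A (ln (t j) + ln (norm x)) - ?M) *v x) /\<^sub>R \<mu> ?M + (?M /\<^sub>R \<mu> ?M - B /\<^sub>R \<mu> B) *v x"
          by (simp add: matrix_vector_mult_diff_rdistrib scaleR_diff_right scaleR_matrix_vector_assoc[symmetric])
        then show "dist (rescaling (twist A) 0 (t j) x) ((B *v x) /\<^sub>R \<mu> B) < \<epsilon>"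
          using norm_triangle_lt[OF add_le_less_mono[OF 1 2]] by (simp only: dist_norm field_sum_of_halves)
      qed
    qed
  qed
  then have "locally_uniform_limit (\<lambda>j. rescaling (twist A) 0 (t j)) (\<lambda>x. (B *v x) /\<^sub>R \<mu> B)"
    unfolding locally_uniform_limit_def by (meson zero_less_one)
  moreover have "decseq t"
    using s by (auto simp: decseq_def t_def strict_mono_less_eq)
  moreover have "t \<longlonglongrightarrow> 0"
    unfolding t_def[abs_def]
    by (intro filterlim_compose[OF exp_at_bot] filterlim_compose[OF filterlim_uminus_at_bot_at_top]
        filterlim_compose[OF filterlim_real_sequentially] filterlim_subseq[OF s])
  ultimately show ?thesis
    unfolding generalized_derivative_def \<mu>_def by (intro exI[of _ t]) (auto simp: t_def)
qed

text \<open>To reach a point \<open>q\<close> of \<open>X\<close>, take nodes whose normalized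
  values tend to \<open>q\<close>; by compactness a subsequence of them converges to a matrix
  \<open>B\<close>, and \<open>B\<close> yields a generalized derivative with value
  \<open>q\<close>.\<close>

lemma point_evaluation_infinitesimal_space_twist:
  assumes "norm e = 1" "closed X" and val: "\<And>k. normalized_image e (G k) \<in> X"
    and dense: "\<And>q. q \<in> X \<Longrightarrow> \<exists>s. strict_mono s \<and> (\<lambda>j. normalized_image e (G (s j))) \<longlonglongrightarrow> q"
  shows "point_evaluation e ` infinitesimal_space 0 (twist A) = X"
proof
  show "point_evaluation e ` infinitesimal_space 0 (twist A) \<subseteq> X"
    using generalized_derivative_value_mem[OF _ assms(1,2) val]
    by (auto simp: point_evaluation_def infinitesimal_space_def)
  show "X \<subseteq> point_evaluation e ` infinitesimal_space 0 (twist A)"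
  proof
    fix q assume "q \<in> X"
    then obtain s where s: "strict_mono s" "(\<lambda>j. normalized_image e (G (s j))) \<longlonglongrightarrow> q"
      using dense by blast
    obtain B r where Br: "B \<in> nondeg c C" "strict_mono r" "((\<lambda>j. G (s j)) \<circ> r) \<longlonglongrightarrow> B"
      by (rule seq_compactE[OF compact_imp_seq_compact[OF compact_nondeg[of c C]], of "\<lambda>j. G (s j)"])
        (use polygonal_nodes_nondeg in auto)
    have lim: "(\<lambda>j. G ((s \<circ> r) j)) \<longlonglongrightarrow> B" using Br(3) by (simp add: o_def)
    from generalized_derivative_along_nodes[OF strict_mono_o[OF s(1) Br(2)] lim Br(1)]
    have "(\<lambda>x. (B *v x) /\<^sub>R (det B powr (1 / CARD('n)))) \<in> infinitesimal_space 0 (twist A)"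
      by (simp add: infinitesimal_space_def)
    moreover have "(\<lambda>j. normalized_image e (G ((s \<circ> r) j))) \<longlonglongrightarrow> normalized_image e B"
      by (rule continuous_on_tendsto_compose[OF normalized_image_continuous[OF c] lim Br(1)])
        (simp add: polygonal_nodes_nondeg)
    then have "normalized_image e B = q"
      using LIMSEQ_subseq_LIMSEQ[OF s(2) Br(2)] by (simp add: o_def LIMSEQ_unique)
    ultimately show "q \<in> point_evaluation e ` infinitesimal_space 0 (twist A)"
      unfolding point_evaluation_def normalized_image_def by (intro image_eqI) auto
  qed
qed

end

section \<open>Rotations, stretchings and chains\<close>

lemma continuous_on_outer [continuous_intros]:
  assumes "continuous_on S f" "continuous_on S g"
  shows "continuous_on S (\<lambda>x. outer (f x) (g x))"
  unfolding outer_def by (intro continuous_intros assms)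

text \<open>The reflection in the hyperplane orthogonal to \<open>u\<close>, for \<open>u\<close> of
  any length; for \<open>u = 0\<close> it is the identity.\<close>

definition reflection :: "real^'n \<Rightarrow> real^'n^'n" where
  "reflection u = mat 1 - (2 / (u \<bullet> u)) *\<^sub>R outer u u"

lemma reflection_vector_mult: "reflection u *v x = x - (2 * (u \<bullet> x) / (u \<bullet> u)) *\<^sub>R u"
  by (simp add: reflection_def matrix_vector_mult_diff_rdistrib outer_vector_mult
      scaleR_matrix_vector_assoc[symmetric])

lemma reflection_scaleR: "k \<noteq> 0 \<Longrightarrow> reflection (k *\<^sub>R u) = reflection u"
  unfolding matrix_eq by (simp add: reflection_vector_mult)

lemma reflection_involution: "reflection u ** reflection u = mat 1"
  unfolding matrix_eq matrix_vector_mul_assoc[symmetric]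
  by (cases "u = 0") (simp_all add: reflection_vector_mult inner_diff_right)

lemma orthogonal_matrix_reflection: "orthogonal_matrix (reflection u)"
proof -
  have "transpose (reflection u) = reflection u"
    by (simp add: reflection_def vec_eq_iff transpose_def mat_def outer_def mult.commute)
  then show ?thesis by (simp add: orthogonal_matrix reflection_involution)
qed

lemma orthogonal_matrix_inner:
  fixes Q :: "real^'n^'n"
  assumes "orthogonal_matrix Q"
  shows "(Q *v x) \<bullet> (Q *v y) = x \<bullet> y"
  using assms orthogonal_transformation_matrix[of "(*v) Q"] by (simp add: orthogonal_transformation_def)

text \<open>Every reflection is conjugate, by an orthogonal matrix, to the one along a coordinate
  axis. Equality of the determinants makes a product of two reflections a rotation.\<close>

lemma det_reflection_eq:
  fixes u :: "real^'n"
  assumes "u \<noteq> 0"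
  shows "det (reflection u) = det (reflection (axis k 1 :: real^'n))"
proof -
  have "norm (u /\<^sub>R norm u) = 1" using assms by simp
  then obtain Q :: "real^'n^'n" where Q: "orthogonal_matrix Q" "Q *v axis k 1 = u /\<^sub>R norm u"
    using orthogonal_matrix_exists_basis by metis
  define v where "v = Q *v axis k 1"
  have "reflection v ** Q = Q ** reflection (axis k 1)"
    unfolding matrix_eq matrix_vector_mul_assoc[symmetric]
    by (simp add: v_def reflection_vector_mult orthogonal_matrix_inner[OF Q(1)] matrix_vector_mult_diff_distrib matrix_vector_mult_scaleR)
  then have "det (reflection v) * det Q = det Q * det (reflection (axis k 1 :: real^'n))"
    by (metis det_mul)
  moreover have "det Q \<noteq> 0" using det_orthogonal_matrix[OF Q(1)] by auto
  moreover have "reflection v = reflection u"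
    unfolding v_def Q(2) using assms by (intro reflection_scaleR) simp
  ultimately show ?thesis by simp
qed

lemma continuous_on_reflection [continuous_intros]:
  assumes "continuous_on S f" "\<And>x. x \<in> S \<Longrightarrow> f x \<noteq> 0"
  shows "continuous_on S (\<lambda>x. reflection (f x))"
  unfolding reflection_def by (intro continuous_intros assms) (use assms(2) in auto)

definition rotations :: "(real^'n^'n) set" where
  "rotations = {R. orthogonal_matrix R \<and> det R = 1}"

lemma compact_rotations: "compact (rotations :: (real^'n^'n) set)"
proof (rule compact_eq_bounded_closed[THEN iffD2], intro conjI)
  show "bounded (rotations :: (real^'n^'n) set)"
  proof (rule boundedI)
    fix R :: "real^'n^'n" assume "R \<in> rotations"
    then have "norm (R $ i) = 1" for i
      by (simp add: rotations_def orthogonal_matrix_orthonormal_rows row_def)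
    then show "norm R \<le> real CARD('n)"
      using L2_set_le_sum[of UNIV "\<lambda>i. norm (R $ i)"] by (simp add: norm_vec_def[of R])
  qed
  have "continuous_on UNIV (transpose :: real^'n^'n \<Rightarrow> real^'n^'n)"
    unfolding transpose_def[abs_def] by (intro continuous_intros)
  then show "closed (rotations :: (real^'n^'n) set)"
    unfolding rotations_def orthogonal_matrix
    by (intro closed_Collect_conj closed_Collect_eq continuous_intros)
qed

text \<open>This is \<open>R ** (mat 1 + (c - 1) *\<^sub>R outer e e)\<close>: for a unit vector
  \<open>e\<close>, a stretching by \<open>c\<close> along \<open>e\<close> followed by
  \<open>R\<close>.\<close>

definition stretch :: "real^'n \<Rightarrow> real^'n^'n \<Rightarrow> real \<Rightarrow> real^'n^'n" where
  "stretch e R c = R + (c - 1) *\<^sub>R outer (R *v e) e"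

lemma stretch_vector_mult:
  assumes "norm e = 1"
  shows "stretch e R c *v e = c *\<^sub>R (R *v e)"
proof -
  have "stretch e R c *v e = R *v e + (c - 1) *\<^sub>R (R *v e)"
    using assms unfolding stretch_def
    by (simp only: matrix_vector_mult_add_rdistrib scaleR_matrix_vector_assoc[symmetric] outer_vector_mult
        norm_eq_1 scaleR_one)
  then show ?thesis by (simp add: scaleR_diff_left)
qed

lemma det_stretch:
  fixes R :: "real^'n^'n"
  assumes "R \<in> rotations"
  shows "det (stretch (axis k 1) R c) = c"
proof -
  let ?D = "mat 1 + (c - 1) *\<^sub>R outer (axis k 1) (axis k 1) :: real^'n^'n"
  have "det ?D = (\<Prod>i\<in>UNIV. ?D $ i $ i)"
    by (rule det_diagonal) (auto simp: mat_def outer_def axis_def)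
  also have "\<dots> = (\<Prod>i\<in>UNIV. if i = k then c else 1)"
    by (intro prod.cong) (auto simp: mat_def outer_def axis_def)
  also have "\<dots> = c" by simp
  finally have "det ?D = c" .
  moreover have "stretch (axis k 1) R c = R ** ?D"
    unfolding matrix_eq stretch_def
    by (simp add: matrix_vector_mul_assoc[symmetric] matrix_vector_mult_add_rdistrib matrix_vector_right_distrib
        scaleR_matrix_vector_assoc[symmetric] outer_vector_mult matrix_vector_mult_scaleR)
  ultimately show ?thesis using assms by (simp add: det_mul rotations_def)
qed

text \<open>\<open>m j\<close> is the position of \<open>a j\<close> in the joined sequence. The
  transitive closure, as opposed to the reflexive one, gives every chain at least one step, so
  \<open>m\<close> is strictly increasing.\<close>

lemma concatenate_chains:
  assumes "\<And>j. (a j, a (Suc j)) \<in> (S j)\<^sup>+"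
  obtains G :: "nat \<Rightarrow> 'a" and m :: "nat \<Rightarrow> nat" where "strict_mono m" "\<And>j. G (m j) = a j"
    "\<And>i j. m j \<le> i \<Longrightarrow> i < m (Suc j) \<Longrightarrow> (G i, G (Suc i)) \<in> S j" "\<And>i. \<exists>j. m j \<le> i \<and> i < m (Suc j)"
proof -
  have "\<exists>n f. n > 0 \<and> f 0 = a j \<and> f n = a (Suc j) \<and> (\<forall>i<n. (f i, f (Suc i)) \<in> S j)" for j
    using assms[of j] unfolding trancl_power relpow_fun_conv by blast
  then obtain n f where n: "\<And>j. n j > (0::nat)" and f: "\<And>j. f j 0 = a j" "\<And>j. f j (n j) = a (Suc j)"
      "\<And>i j. i < n j \<Longrightarrow> (f j i, f j (Suc i)) \<in> S j"
    by metis
  define m where "m j = (\<Sum>i<j. n i)" for j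
  have mSuc: "m (Suc j) = m j + n j" for j by (simp add: m_def)
  have m: "strict_mono m" unfolding strict_mono_Suc_iff using n by (simp add: mSuc)
  \<comment> \<open>\<open>L i\<close> is the number of the chain to which position \<open>i\<close>
    belongs.\<close>
  define L where "L i = (LEAST j. i < m (Suc j))" for i
  have ex: "\<exists>j. m j \<le> i \<and> i < m (Suc j)" for i
  proof -
    have "i < m (Suc i)" using strict_mono_imp_increasing[OF m, of "Suc i"] by simp
    then have 1: "i < m (Suc (L i))" unfolding L_def by (rule LeastI)
    have "m (L i) \<le> i"
    proof (cases "L i")
      case 0 then show ?thesis by (simp add: m_def)
    next
      case (Suc j)
      then have "\<not> i < m (Suc j)" unfolding L_def using not_less_Least by (metis lessI)
      then show ?thesis using Suc by simp
    qed
    with 1 show ?thesis by blast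
  qed
  have L: "L i = j" if "m j \<le> i" "i < m (Suc j)" for i j
    unfolding L_def
  proof (rule Least_equality)
    show "i < m (Suc j)" by (rule that(2))
    fix j' assume "i < m (Suc j')"
    then have "m j < m (Suc j')" using that(1) by linarith
    then show "j \<le> j'" using strict_mono_less[OF m] by auto
  qed
  define G where "G i = f (L i) (i - m (L i))" for i
  have Gm: "G (m j) = a j" for j
    using L[of j "m j"] n[of j] f(1) by (simp add: G_def mSuc)
  have GS: "(G i, G (Suc i)) \<in> S j" if i: "m j \<le> i" "i < m (Suc j)" for i j
  proof -
    have Gi: "G i = f j (i - m j)" by (simp add: G_def L[OF i])
    have "G (Suc i) = f j (Suc (i - m j))"
    proof (cases "Suc i < m (Suc j)")
      case True
      then show ?thesis using L[of j "Suc i"] i(1) by (simp add: G_def Suc_diff_le)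
    next
      case False
      \<comment> \<open>At a junction position \<open>Suc i\<close> already counts to the next
        chain, but the end of one chain and the start of the next are the same point
        \<open>a (Suc j)\<close>.\<close>
      then have "Suc i = m (Suc j)" "Suc (i - m j) = n j" using i by (auto simp: mSuc)
      then show ?thesis using Gm[of "Suc j"] f(2) by simp
    qed
    then show ?thesis using Gi f(3)[of "i - m j" j] i by (simp add: mSuc)
  qed
  show thesis by (rule that[of m G, OF m Gm GS ex])
qed

text \<open>Reading only the first component of \<open>prod_decode j\<close> enumerates a countable
  dense subset with each point repeated at arbitrarily late indices.\<close>

lemma dense_recurrent_sequence:
  fixes X :: "'a::{metric_space,second_countable_topology} set"
  assumes "X \<noteq> {}"
  obtains d :: "nat \<Rightarrow> 'a" where "\<And>j. d j \<in> X"
    "\<And>q \<epsilon> N. q \<in> X \<Longrightarrow> 0 < \<epsilon> \<Longrightarrow> \<exists>j\<ge>N. dist (d j) q < \<epsilon>"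
proof -
  obtain D where D: "countable D" "D \<subseteq> X" "X \<subseteq> closure D" using separable by metis
  have "D \<noteq> {}" using D assms by auto
  show thesis
  proof
    show "from_nat_into D (fst (prod_decode j)) \<in> X" for j
      using from_nat_into[OF \<open>D \<noteq> {}\<close>] D(2) by blast
    fix q \<epsilon> N assume "q \<in> X" "0 < (\<epsilon>::real)"
    then obtain z where z: "z \<in> D" "dist z q < \<epsilon>"
      using D(3) by (metis closure_approachable subsetD)
    obtain i where "from_nat_into D i = z"
      using from_nat_into_surj[OF D(1) z(1)] by blast
    then show "\<exists>j\<ge>N. dist (from_nat_into D (fst (prod_decode j))) q < \<epsilon>"
      using z(2) le_prod_encode_2[of N i] by (intro exI[of _ "prod_encode (i, N)"]) simp
  qed
qed

lemma subsequence_tendsto_of_recurrent: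
  fixes x :: "nat \<Rightarrow> 'a::metric_space"
  assumes "\<And>\<epsilon> N. 0 < \<epsilon> \<Longrightarrow> \<exists>j\<ge>N. dist (x j) q < \<epsilon>"
  shows "\<exists>s. strict_mono s \<and> (\<lambda>j. x (s j)) \<longlonglongrightarrow> q"
proof -
  have "\<exists>s. \<forall>k. dist (x (s k)) q < 1 / real (Suc k) \<and> s k < s (Suc k)"
  proof (rule dependent_nat_choice)
    show "\<exists>j. dist (x j) q < 1 / real (Suc 0)" using assms[of 1 0] by auto
    show "\<exists>j. dist (x j) q < 1 / real (Suc (Suc n)) \<and> i < j" for i n
      using assms[of "1 / real (Suc (Suc n))" "Suc i"] by (auto simp: Suc_le_eq)
  qed
  then obtain s where s: "\<And>k. dist (x (s k)) q < 1 / real (Suc k)" "\<And>k. s k < s (Suc k)" by blast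
  have "(\<lambda>k. dist (x (s k)) q) \<longlonglongrightarrow> 0"
    by (rule tendsto_sandwich[OF _ _ tendsto_const LIMSEQ_Suc[OF lim_1_over_n]])
      (auto intro!: always_eventually less_imp_le s(1) simp del: of_nat_Suc)
  then show ?thesis
    using s(2) by (auto simp: strict_mono_Suc_iff tendsto_dist_iff[of _ q])
qed

section \<open>Lifting the continuum to matrices\<close>

text \<open>The vector \<open>norm q *\<^sub>R p + norm p *\<^sub>R q\<close> bisects the directions
  of \<open>p\<close> and \<open>q\<close>, so its reflection carries one direction to the negative
  of the other. It vanishes only for opposite directions.\<close>

lemma reflection_swap_unit:
  assumes "p \<noteq> 0" "q \<noteq> 0" and w: "norm q *\<^sub>R p + norm p *\<^sub>R q \<noteq> 0"
  shows "norm q *\<^sub>R (reflection (norm q *\<^sub>R p + norm p *\<^sub>R q) *v p) = - norm p *\<^sub>R q"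
proof -
  let ?w = "norm q *\<^sub>R p + norm p *\<^sub>R q"
  have "?w \<bullet> p = norm p * (norm p * norm q + p \<bullet> q)"
    by (simp add: dot_square_norm[of p] inner_commute power2_eq_square algebra_simps)
  moreover have ww: "?w \<bullet> ?w = 2 * norm p * norm q * (norm p * norm q + p \<bullet> q)"
    by (simp add: dot_square_norm[of p] dot_square_norm[of q] inner_commute power2_eq_square algebra_simps)
  moreover have "norm p * norm q + p \<bullet> q \<noteq> 0"
    using w ww by (metis inner_eq_zero_iff mult_zero_right)
  moreover have "2 * (\<alpha> * \<kappa>) / (2 * \<alpha> * \<beta> * \<kappa>) = 1 / \<beta>" if "\<alpha> \<noteq> 0" "\<kappa> \<noteq> 0" for \<alpha> \<beta> \<kappa> :: real
    using that by simp
  ultimately have "2 * (?w \<bullet> p) / (?w \<bullet> ?w) = 1 / norm q"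
    using assms(1) by (simp only: norm_eq_zero not_False_eq_True)
  then have "reflection ?w *v p = p - (1 / norm q) *\<^sub>R ?w"
    unfolding reflection_vector_mult by (rule arg_cong)
  then show ?thesis using assms(2) by (simp add: scaleR_diff_right scaleR_add_right)
qed

text \<open>A rotation carrying the direction of \<open>p\<close> to that of \<open>q\<close>: the
  first reflection gives \<open>- p\<close>, the second sends this to the direction of
  \<open>q\<close>. The explicit formula is continuous in \<open>p\<close> and \<open>q\<close> and
  gives the identity for \<open>q = p\<close>.\<close>

definition turn :: "real^'n \<Rightarrow> real^'n \<Rightarrow> real^'n^'n" where
  "turn p q = reflection (norm q *\<^sub>R p + norm p *\<^sub>R q) ** reflection p"

context
  fixes p q :: "real^'n"
  assumes pq: "p \<noteq> 0" "q \<noteq> 0" "norm q *\<^sub>R p + norm p *\<^sub>R q \<noteq> 0"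
begin

lemma turn_vector_mult: "norm q *\<^sub>R (turn p q *v p) = norm p *\<^sub>R q"
proof -
  have "reflection p *v p = - p" using pq(1) by (simp add: reflection_vector_mult vec_eq_iff)
  then have "turn p q *v p = - (reflection (norm q *\<^sub>R p + norm p *\<^sub>R q) *v p)"
    using matrix_vector_mult_scaleR[of _ "-1" p] by (simp add: turn_def matrix_vector_mul_assoc[symmetric])
  then show ?thesis using reflection_swap_unit[OF pq] by simp
qed

lemma turn_rotation: "turn p q \<in> rotations"
proof -
  have "det (turn p q) = det (reflection p) * det (reflection p)"
    using det_reflection_eq[OF pq(1)] det_reflection_eq[OF pq(3)] by (simp add: turn_def det_mul)
  also have "\<dots> = det (mat 1 :: real^'n^'n)"
    by (simp only: reflection_involution flip: det_mul)
  finally show ?thesis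
    by (simp add: rotations_def turn_def orthogonal_matrix_mul orthogonal_matrix_reflection)
qed

end

lemma turn_self:
  assumes "p \<noteq> 0"
  shows "turn p p = mat 1"
proof -
  have "norm p *\<^sub>R p + norm p *\<^sub>R p = (2 * norm p) *\<^sub>R p" by (simp flip: scaleR_left_distrib)
  then show ?thesis
    using assms reflection_scaleR[of "2 * norm p" p] by (simp add: turn_def reflection_involution)
qed

lemma rotations_mult: "R \<in> rotations \<Longrightarrow> S \<in> rotations \<Longrightarrow> R ** S \<in> rotations"
  by (simp add: rotations_def orthogonal_matrix_mul det_mul)

section \<open>Lifts of the points of \<open>X\<close> to matrices\<close>

context
  fixes X :: "(real^'n) set" and k :: 'n and X_lift :: "(real^'n^'n) set"
    and e :: "real^'n" and factor :: "real^'n \<Rightarrow> real"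
  defines "e \<equiv> axis k 1"
    and "factor \<equiv> \<lambda>p. norm p powr (CARD('n) / (CARD('n) - 1))"
    and "X_lift \<equiv> {stretch e R (factor p) |R p. R \<in> rotations \<and> p \<in> X \<and> norm p *\<^sub>R (R *v e) = p}"
  assumes card: "CARD('n) \<ge> 2" and X0: "0 \<notin> X" and X: "compact X" "connected X" "X \<noteq> {}"
begin

text \<open>The determinant is \<open>factor p\<close>, so normalization leaves a vector of length
  \<open>factor p\<close> to the power \<open>1 - 1/n\<close>, \<open>n\<close> being the dimension.
  The exponent \<open>n/(n-1)\<close> in \<open>factor\<close> makes this
  \<open>norm p\<close>.\<close>

lemma normalized_image_stretch:
  assumes "R \<in> rotations" "p \<noteq> 0" "norm p *\<^sub>R (R *v e) = p"
  shows "normalized_image e (stretch e R (factor p)) = p"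
proof -
  let ?n = "real CARD('n)"
  have n: "?n > 1" using card by simp
  have "factor p / factor p powr (1 / ?n) = norm p powr (?n / (?n - 1) - ?n / (?n - 1) * (1 / ?n))"
    using assms(2) by (simp add: factor_def powr_powr powr_diff)
  also have "?n / (?n - 1) - ?n / (?n - 1) * (1 / ?n) = 1"
    using n by (simp flip: diff_divide_distrib)
  finally have "factor p / factor p powr (1 / ?n) = norm p" by simp
  then show ?thesis
    using assms(3) unfolding normalized_image_def
    by (simp add: stretch_vector_mult det_stretch[OF assms(1)] e_def divide_inverse_commute)
qed

lemma X_lower_bound:
  obtains a where "a > 0" "\<And>p. p \<in> X \<Longrightarrow> a \<le> norm p"
proof -
  obtain x where "x \<in> X" "\<And>y. y \<in> X \<Longrightarrow> dist 0 x \<le> dist 0 y"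
    using distance_attains_inf[OF compact_imp_closed[OF X(1)] X(3)] by metis
  then show thesis using X0 by (intro that[of "norm x"]) auto
qed

lemma continuous_on_factor:
  assumes "continuous_on S f" "\<And>x. x \<in> S \<Longrightarrow> f x \<in> X"
  shows "continuous_on S (\<lambda>x. factor (f x))"
  unfolding factor_def by (intro continuous_intros assms) (use assms(2) X0 in force)

text \<open>The norm is bounded by compactness of \<open>rotations \<times> X\<close>; the
  determinant \<open>factor p\<close> is bounded below because \<open>X\<close> keeps a positive
  distance from \<open>0\<close>.\<close>

lemma lift_nondeg:
  obtains c C where "c > 0" "X_lift \<subseteq> nondeg c C"
proof -
  obtain a where a: "a > 0" "\<And>p. p \<in> X \<Longrightarrow> a \<le> norm p" using X_lower_bound by metis
  have "continuous_on (rotations \<times> X) (\<lambda>z. stretch e (fst z) (factor (snd z)))"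
    unfolding stretch_def
    by (intro continuous_on_add continuous_on_scaleR continuous_on_diff continuous_on_outer
        continuous_on_matrix_vector_mult continuous_on_fst continuous_on_snd continuous_on_id
        continuous_on_const continuous_on_factor) auto
  then have "bounded ((\<lambda>z. stretch e (fst z) (factor (snd z))) ` (rotations \<times> X))"
    by (intro compact_imp_bounded compact_continuous_image compact_Times compact_rotations X)
  then obtain C where C: "\<And>R p. R \<in> rotations \<Longrightarrow> p \<in> X \<Longrightarrow> norm (stretch e R (factor p)) \<le> C"
    unfolding bounded_iff by auto
  show thesis
  proof
    show "a powr (CARD('n) / (CARD('n) - 1)) > 0" using a by simp
    show "X_lift \<subseteq> nondeg (a powr (CARD('n) / (CARD('n) - 1))) C"
    proof
      fix A assume "A \<in> X_lift"
      then obtain R p where A: "A = stretch e R (factor p)" "R \<in> rotations" "p \<in> X"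
        by (auto simp: X_lift_def)
      have "det A = factor p" using A by (simp add: e_def det_stretch)
      also have "\<dots> \<ge> a powr (CARD('n) / (CARD('n) - 1))"
        unfolding factor_def using a A(3) by (intro powr_mono2) auto
      finally show "A \<in> nondeg (a powr (CARD('n) / (CARD('n) - 1))) C"
        using C A by (simp add: nondeg_def)
    qed
  qed
qed

lemma lift_value_mem:
  assumes "A \<in> X_lift"
  shows "normalized_image e A \<in> X"
proof -
  obtain R p where "A = stretch e R (factor p)" "R \<in> rotations" "p \<in> X" "norm p *\<^sub>R (R *v e) = p"
    using assms by (auto simp: X_lift_def)
  moreover from this have "p \<noteq> 0" using X0 by auto
  ultimately show ?thesis by (simp add: normalized_image_stretch)
qed

text \<open>In dimension at least two some rotation takes \<open>e\<close> to the direction of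
  \<open>p\<close>.\<close>

lemma lift_exists:
  assumes "p \<in> X"
  shows "\<exists>A\<in>X_lift. normalized_image e A = p"
proof -
  have "p \<noteq> 0" using assms X0 by auto
  then obtain f where f: "orthogonal_transformation f" "det (matrix f) = 1" "f e = p /\<^sub>R norm p"
    using rotation_exists_1[OF card, of e "p /\<^sub>R norm p"] by (auto simp: e_def)
  then have lin: "linear f" by (simp add: orthogonal_transformation_def)
  have R: "matrix f \<in> rotations"
    using f(1,2) by (simp add: rotations_def orthogonal_transformation_matrix)
  have v: "norm p *\<^sub>R (matrix f *v e) = p"
    unfolding matrix_vector_mul(2)[OF lin, THEN fun_cong] f(3) using \<open>p \<noteq> 0\<close> by simp
  then have "stretch e (matrix f) (factor p) \<in> X_lift"
    using R assms unfolding X_lift_def by blast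
  then show ?thesis using normalized_image_stretch[OF R \<open>p \<noteq> 0\<close> v] by blast
qed

text \<open>The new lift is obtained by composing \<open>R\<close> with \<open>turn p q\<close> and
  adapting the stretching factor. It depends continuously on \<open>(R, p, q)\<close> and is the old
  lift for \<open>q = p\<close>; uniform continuity on a compact set gives one
  \<open>\<epsilon>\<close> for all lifts.\<close>

lemma lift_step:
  assumes "\<delta> > 0"
  obtains \<epsilon> where "\<epsilon> > 0" "\<And>A q. A \<in> X_lift \<Longrightarrow> q \<in> X \<Longrightarrow> dist q (normalized_image e A) < \<epsilon> \<Longrightarrow>
    \<exists>B\<in>X_lift. normalized_image e B = q \<and> dist B A < \<delta>"
proof -
  obtain a where a: "a > 0" "\<And>p. p \<in> X \<Longrightarrow> a \<le> norm p" using X_lower_bound by metis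
  \<comment> \<open>Opposite directions have to be avoided for \<open>turn\<close>. Opposite
    \<open>p\<close> and \<open>q\<close> are at distance
    \<open>norm p + norm q \<ge> 2 * a\<close>, so the bound \<open>a\<close> excludes them and
    keeps \<open>Z\<close> compact.\<close>
  define Z where "Z = {z. fst z \<in> (rotations :: (real^'n^'n) set) \<and> fst (snd z) \<in> X \<and> snd (snd z) \<in> X \<and>
      dist (fst (snd z)) (snd (snd z)) \<le> a}"
  have Z_ne: "norm q *\<^sub>R p + norm p *\<^sub>R q \<noteq> 0" if "p \<in> X" "q \<in> X" "dist p q \<le> a" for p q
  proof
    assume 0: "norm q *\<^sub>R p + norm p *\<^sub>R q = 0"
    have "norm q *\<^sub>R (p - q) = (norm q *\<^sub>R p + norm p *\<^sub>R q) - (norm p + norm q) *\<^sub>R q"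
      by (simp add: algebra_simps)
    then have "norm (norm q *\<^sub>R (p - q)) = norm (- ((norm p + norm q) *\<^sub>R q))"
      unfolding 0 by simp
    then have "norm q * norm (p - q) = (norm p + norm q) * norm q"
      unfolding norm_minus_cancel norm_scaleR by simp
    then have "norm (p - q) = norm p + norm q" using a that(2) by (auto simp: mult.commute)
    then show False using a(1) a(2)[OF that(1)] a(2)[OF that(2)] that(3) by (simp add: dist_norm)
  qed
  have "compact Z"
  proof -
    have "Z = (rotations \<times> X \<times> X) \<inter> {z. dist (fst (snd z)) (snd (snd z)) \<le> a}"
      by (auto simp: Z_def)
    moreover have "closed {z::(real^'n^'n) \<times> (real^'n) \<times> (real^'n). dist (fst (snd z)) (snd (snd z)) \<le> a}"
      by (intro closed_Collect_le continuous_on_dist continuous_on_fst continuous_on_snd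
          continuous_on_id continuous_on_const)
    ultimately show ?thesis
      by (simp add: compact_Int_closed compact_Times compact_rotations X)
  qed
  \<comment> \<open>\<open>\<Phi> (R, p, q)\<close> takes \<open>e\<close> to the direction of
    \<open>q\<close> whenever \<open>R\<close> takes it to that of \<open>p\<close>, and
    \<open>\<Theta>\<close> is the resulting lift of \<open>q\<close>.\<close>
  define \<Phi> where "\<Phi> z = turn (fst (snd z)) (snd (snd z)) ** fst z" for z :: "(real^'n^'n) \<times> (real^'n) \<times> (real^'n)"
  define \<Theta> where "\<Theta> z = stretch e (\<Phi> z) (factor (snd (snd z)))" for z
  have \<Phi>: "continuous_on Z \<Phi>"
    unfolding \<Phi>_def turn_def
    by (intro continuous_on_matrix_mult continuous_on_reflection continuous_on_add continuous_on_scaleR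
        continuous_on_norm continuous_on_fst continuous_on_snd continuous_on_id Z_ne)
      (use X0 in \<open>auto simp: Z_def\<close>)
  have "continuous_on Z \<Theta>"
    unfolding \<Theta>_def stretch_def
    by (intro continuous_on_add continuous_on_scaleR continuous_on_diff continuous_on_outer \<Phi>
        continuous_on_matrix_vector_mult continuous_on_fst continuous_on_snd continuous_on_id
        continuous_on_const continuous_on_factor) (auto simp: Z_def)
  then have "uniformly_continuous_on Z \<Theta>"
    using \<open>compact Z\<close> by (rule compact_uniformly_continuous)
  then obtain \<epsilon> where \<epsilon>: "\<epsilon> > 0" "\<And>z z'. z \<in> Z \<Longrightarrow> z' \<in> Z \<Longrightarrow> dist z' z < \<epsilon> \<Longrightarrow> dist (\<Theta> z') (\<Theta> z) < \<delta>"
    unfolding uniformly_continuous_on_def using assms by blast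
  show thesis
  proof (rule that[of "min \<epsilon> a"])
    show "min \<epsilon> a > 0" using \<epsilon>(1) a(1) by simp
    fix A q assume "A \<in> X_lift" and q: "q \<in> X" and dq: "dist q (normalized_image e A) < min \<epsilon> a"
    then obtain R p where A: "A = stretch e R (factor p)" and R: "R \<in> rotations" and p: "p \<in> X"
        and Rp: "norm p *\<^sub>R (R *v e) = p"
      by (auto simp: X_lift_def)
    have ne: "p \<noteq> 0" "q \<noteq> 0" using p q X0 by auto
    have d: "dist q p < \<epsilon>" "dist p q \<le> a"
      using dq normalized_image_stretch[OF R ne(1) Rp] by (auto simp: A dist_commute)
    have Z: "(R, p, q) \<in> Z" "(R, p, p) \<in> Z" using R p q d a(1) by (auto simp: Z_def)
    have "dist (R, p, q) (R, p, p) < \<epsilon>" using d(1) by (simp add: dist_Pair_Pair)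
    from \<epsilon>(2)[OF Z(2,1) this] have dist: "dist (\<Theta> (R, p, q)) (\<Theta> (R, p, p)) < \<delta>" .
    have \<Theta>A: "\<Theta> (R, p, p) = A" by (simp add: \<Theta>_def \<Phi>_def turn_self[OF ne(1)] A)
    note t = Z_ne[OF p q d(2)]
    define S where "S = turn p q ** R"
    have S: "S \<in> rotations"
      unfolding S_def by (intro rotations_mult turn_rotation ne t R)
    have Sq: "norm q *\<^sub>R (S *v e) = q"
    proof -
      have "norm p *\<^sub>R norm q *\<^sub>R (S *v e) = norm q *\<^sub>R (turn p q *v (norm p *\<^sub>R (R *v e)))"
        by (simp add: S_def matrix_vector_mult_scaleR matrix_vector_mul_assoc[symmetric])
      also have "\<dots> = norm p *\<^sub>R q"
        unfolding Rp by (rule turn_vector_mult[OF ne t])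
      finally have *: "norm p *\<^sub>R norm q *\<^sub>R (S *v e) = norm p *\<^sub>R q" .
      show ?thesis by (rule scaleR_left_imp_eq[OF _ *]) (use ne(1) in simp)
    qed
    have "stretch e S (factor q) \<in> X_lift" using S Sq q unfolding X_lift_def by blast
    moreover have "normalized_image e (stretch e S (factor q)) = q"
      by (rule normalized_image_stretch[OF S ne(2) Sq])
    moreover have "dist (stretch e S (factor q)) A < \<delta>"
      using dist unfolding \<Theta>A by (simp add: \<Theta>_def \<Phi>_def S_def)
    ultimately show "\<exists>B\<in>X_lift. normalized_image e B = q \<and> dist B A < \<delta>" by blast
  qed
qed

text \<open>Being the value of a lift reachable from \<open>A\<close> by steps shorter than
  \<open>\<delta>\<close> is a locally constant property on \<open>X\<close>, because the
  \<open>\<epsilon>\<close> of \<open>lift_step\<close> is uniform; connectedness of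
  \<open>X\<close> spreads it to \<open>q\<close>.\<close>

lemma lift_chain:
  assumes "\<delta> > 0" "A \<in> X_lift" "q \<in> X"
  shows "\<exists>B\<in>X_lift. normalized_image e B = q \<and>
    (A, B) \<in> {(A, B). A \<in> X_lift \<and> B \<in> X_lift \<and> dist B A < \<delta>}\<^sup>+"
proof -
  let ?S = "{(A, B). A \<in> X_lift \<and> B \<in> X_lift \<and> dist B A < \<delta>}"
  define P where "P x \<longleftrightarrow> (\<exists>B\<in>X_lift. normalized_image e B = x \<and> (A, B) \<in> ?S\<^sup>+)" for x
  obtain \<epsilon> where \<epsilon>: "\<epsilon> > 0" "\<And>A q. A \<in> X_lift \<Longrightarrow> q \<in> X \<Longrightarrow> dist q (normalized_image e A) < \<epsilon> \<Longrightarrow>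
    \<exists>B\<in>X_lift. normalized_image e B = q \<and> dist B A < \<delta>"
    using lift_step[OF assms(1)] by blast
  have step: "P y" if x: "P x" and y: "y \<in> X" "dist y x < \<epsilon>" for x y
  proof -
    obtain B where B: "B \<in> X_lift" "normalized_image e B = x" "(A, B) \<in> ?S\<^sup>+" using \<open>P x\<close> P_def by blast
    obtain B' where B': "B' \<in> X_lift" "normalized_image e B' = y" "dist B' B < \<delta>"
      using \<epsilon>(2)[OF B(1) y(1)] y(2) B(2) by blast
    have "(B, B') \<in> ?S" using B(1) B'(1,3) by simp
    with B(3) have "(A, B') \<in> ?S\<^sup>+" by (rule trancl_into_trancl)
    then show ?thesis using B' P_def by blast
  qed
  \<comment> \<open>The step from \<open>A\<close> to itself has length \<open>0 < \<delta>\<close>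
    and so is a chain.\<close>
  have "P (normalized_image e A)"
    unfolding P_def using assms(1,2) by (intro bexI[of _ A]) auto
  moreover have "\<exists>T. openin (top_of_set X) T \<and> x \<in> T \<and> (\<forall>y\<in>T. \<forall>z\<in>T. P y \<longrightarrow> P z)" if "x \<in> X" for x
  proof (intro exI[of _ "X \<inter> ball x (\<epsilon> / 2)"] conjI ballI impI)
    show "openin (top_of_set X) (X \<inter> ball x (\<epsilon> / 2))" by (intro openin_open_Int open_ball)
    show "x \<in> X \<inter> ball x (\<epsilon> / 2)" using that \<epsilon>(1) by simp
    fix y z assume yz: "y \<in> X \<inter> ball x (\<epsilon> / 2)" "z \<in> X \<inter> ball x (\<epsilon> / 2)" "P y"
    have "dist z y < \<epsilon>" using yz dist_triangle_half_r[of x z \<epsilon> y] by auto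
    then show "P z" using step[OF yz(3)] yz(2) by blast
  qed
  ultimately have "P q"
    using connected_induction_simple[OF X(2) lift_value_mem[OF assms(2)] assms(3), of P] by blast
  then show ?thesis by (simp add: P_def)
qed

text \<open>Chains run from each point of a recurrent dense sequence to the next, the
  \<open>j\<close>-th with steps below \<open>\<delta> / real (Suc j)\<close>. The steps tend to
  \<open>0\<close>, yet every point of \<open>X\<close> is approached again and again. The lifts are
  chosen successively, since the end of a chain is the start of the next.\<close>

lemma lift_sequence:
  assumes "\<delta> > 0"
  obtains G where "\<And>i. G i \<in> X_lift" "\<And>i. norm (G (Suc i) - G i) < \<delta>"
    "(\<lambda>i. G (Suc i) - G i) \<longlonglongrightarrow> 0"
    "\<And>q. q \<in> X \<Longrightarrow> \<exists>s. strict_mono s \<and> (\<lambda>j. normalized_image e (G (s j))) \<longlonglongrightarrow> q"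
proof -
  obtain d :: "nat \<Rightarrow> real^'n" where d: "\<And>j. d j \<in> X" "\<And>q \<epsilon> N. q \<in> X \<Longrightarrow> 0 < \<epsilon> \<Longrightarrow> \<exists>j\<ge>N. dist (d j) q < \<epsilon>"
    by (rule dense_recurrent_sequence[OF X(3)]) blast
  define S where "S j = {(A, B). A \<in> X_lift \<and> B \<in> X_lift \<and> dist B A < \<delta> / real (Suc j)}" for j
  have "\<exists>a. \<forall>j. (a j \<in> X_lift \<and> normalized_image e (a j) = d j) \<and> (a j, a (Suc j)) \<in> (S j)\<^sup>+"
  proof (rule dependent_nat_choice)
    show "\<exists>A. A \<in> X_lift \<and> normalized_image e A = d 0" using lift_exists[OF d(1)] by blast
    fix A j assume "A \<in> X_lift \<and> normalized_image e A = d j"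
    then show "\<exists>B. (B \<in> X_lift \<and> normalized_image e B = d (Suc j)) \<and> (A, B) \<in> (S j)\<^sup>+"
      using lift_chain[of "\<delta> / real (Suc j)" A "d (Suc j)"] d(1) assms unfolding S_def by auto
  qed
  then obtain a where a: "\<And>j. normalized_image e (a j) = d j" "\<And>j. (a j, a (Suc j)) \<in> (S j)\<^sup>+" by blast
  obtain G m where G: "strict_mono m" "\<And>j. G (m j) = a j"
    "\<And>i j. m j \<le> i \<Longrightarrow> i < m (Suc j) \<Longrightarrow> (G i, G (Suc i)) \<in> S j" "\<And>i. \<exists>j. m j \<le> i \<and> i < m (Suc j)"
    by (rule concatenate_chains[where S = S and a = a, OF a(2)]) blast
  have GS: "\<exists>j. i < m (Suc j) \<and> (G i, G (Suc i)) \<in> S j" for i using G(3,4) by blast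
  show thesis
  proof (rule that[of G])
    show "G i \<in> X_lift" for i using GS[of i] by (auto simp: S_def)
    show "norm (G (Suc i) - G i) < \<delta>" for i
    proof -
      obtain j where "norm (G (Suc i) - G i) < \<delta> / real (Suc j)" using GS[of i] by (auto simp: S_def dist_norm)
      also have "\<dots> \<le> \<delta> / 1" using assms by (intro divide_left_mono) auto
      finally show ?thesis by simp
    qed
    show "(\<lambda>i. G (Suc i) - G i) \<longlonglongrightarrow> 0"
    proof (rule LIMSEQ_I)
      fix r :: real assume "0 < r"
      obtain J where J: "\<delta> / r < real J" using reals_Archimedean2 by blast
      show "\<exists>N. \<forall>i\<ge>N. norm (G (Suc i) - G i - 0) < r"
      proof (intro exI[of _ "m J"] allI impI)
        fix i assume "m J \<le> i"
        obtain j where j: "i < m (Suc j)" "(G i, G (Suc i)) \<in> S j" using GS by blast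
        have "m J < m (Suc j)" using \<open>m J \<le> i\<close> j(1) by simp
        then have "J < Suc j" using strict_mono_less[OF G(1)] by blast
        then have "\<delta> / r < real (Suc j)" using J by linarith
        then have "\<delta> / real (Suc j) < r" using \<open>0 < r\<close> by (simp add: field_simps del: of_nat_Suc)
        then show "norm (G (Suc i) - G i - 0) < r" using j(2) by (simp add: S_def dist_norm del: of_nat_Suc)
      qed
    qed
    fix q assume "q \<in> X"
    show "\<exists>s. strict_mono s \<and> (\<lambda>j. normalized_image e (G (s j))) \<longlonglongrightarrow> q"
    proof (rule subsequence_tendsto_of_recurrent)
      fix \<epsilon> :: real and N assume "0 < \<epsilon>"
      then obtain j where "j \<ge> N" "dist (d j) q < \<epsilon>" using d(2)[OF \<open>q \<in> X\<close>] by blast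
      moreover have "m j \<ge> j" by (rule strict_mono_imp_increasing[OF G(1)])
      ultimately show "\<exists>j\<ge>N. dist (normalized_image e (G j)) q < \<epsilon>"
        using G(2) a(1) by (intro exI[of _ "m j"]) auto
    qed
  qed
qed

text \<open>The nodes are lifts of points of \<open>X\<close>, but the interpolating segments leave
  \<open>X_lift\<close>; the weaker constants \<open>c/2\<close> and \<open>C+1\<close> absorb
  this.\<close>

lemma quasiconformal_with_prescribed_evaluation:
  "\<exists>f :: real^'n \<Rightarrow> real^'n. quasiconformal UNIV f \<and> point_evaluation e ` infinitesimal_space 0 f = X"
proof -
  obtain c C where c: "c > 0" "X_lift \<subseteq> nondeg c C" by (rule lift_nondeg)
  have "c / 2 > 0" using c(1) by simp
  obtain d where d: "0 < d"
    "\<And>(A :: real \<Rightarrow> real^'n^'n) A' E. (\<And>u. A u \<in> nondeg (c/2) (C+1)) \<Longrightarrow>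
      (\<And>u v. norm (A u - A v) \<le> d * \<bar>u - v\<bar>) \<Longrightarrow> countable E \<Longrightarrow>
      (\<And>u. u \<notin> E \<Longrightarrow> (A has_vector_derivative A' u) (at u)) \<Longrightarrow>
      (\<And>u. u \<notin> E \<Longrightarrow> norm (A' u) \<le> d) \<Longrightarrow> quasiconformal UNIV (twist A) \<and> inj (twist A)"
    by (rule quasiconformal_twist[OF \<open>c / 2 > 0\<close>]) blast
  obtain d' where d': "d' > 0" "\<And>A B :: real^'n^'n. A \<in> nondeg c C \<Longrightarrow> dist B A < d' \<Longrightarrow> det B \<ge> c/2"
    by (rule nondeg_perturb[of "c/2" c]) (use c(1) in auto)
  \<comment> \<open>\<open>d\<close> limits the slope of the path, \<open>d'\<close> protects the
    determinants of the interpolated matrices, and 1 limits the growth of their norms.\<close>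
  define \<delta> where "\<delta> = min d (min d' 1)"
  have \<delta>: "\<delta> > 0" "\<delta> \<le> d" "\<delta> \<le> d'" "\<delta> \<le> 1" using d(1) d'(1) by (auto simp: \<delta>_def)
  obtain G where G: "\<And>i. G i \<in> X_lift" "\<And>i. norm (G (Suc i) - G i) < \<delta>"
    "(\<lambda>i. G (Suc i) - G i) \<longlonglongrightarrow> 0"
    "\<And>q. q \<in> X \<Longrightarrow> \<exists>s. strict_mono s \<and> (\<lambda>j. normalized_image e (G (s j))) \<longlonglongrightarrow> q"
    by (rule lift_sequence[OF \<delta>(1)]) blast
  \<comment> \<open>The absolute value makes the path run through all nodes as \<open>u\<close>
    tends to \<open>-\<infinity>\<close> and extends it to positive \<open>u\<close> with the same
    Lipschitz constant.\<close>
  define A where "A = (\<lambda>u. polygonal G \<bar>u\<bar>)"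
  have nd: "A u \<in> nondeg (c/2) (C+1)" for u
  proof -
    let ?g = "G (nat \<lfloor>\<bar>u\<bar>\<rfloor>)"
    have near: "norm (A u - ?g) < \<delta>"
      unfolding A_def by (rule order_le_less_trans[OF norm_polygonal_diff_node[of "\<bar>u\<bar>" G] G(2)]) simp
    have g: "?g \<in> nondeg c C" using G(1) c(2) by blast
    have "det (A u) \<ge> c/2" using d'(2)[OF g] near \<delta>(3) by (simp add: dist_norm)
    moreover have "norm (A u) \<le> C + 1"
      using norm_triangle_sub[of "A u" ?g] near \<delta>(4) nondegD(2)[OF g] by linarith
    ultimately show ?thesis by (simp add: nondeg_def)
  qed
  have lip: "norm (A u - A v) \<le> d * \<bar>u - v\<bar>" for u v
  proof -
    have "norm (A u - A v) \<le> d * \<bar>\<bar>u\<bar> - \<bar>v\<bar>\<bar>"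
      unfolding A_def using G(2) \<delta>(2) d(1)
      by (intro polygonal_lipschitz[of 0]) (auto intro: less_imp_le order_less_le_trans)
    also have "\<dots> \<le> d * \<bar>u - v\<bar>" using d(1) by (intro mult_left_mono) auto
    finally show ?thesis .
  qed
  define A' where "A' u = sgn u *\<^sub>R (G (Suc (nat \<lfloor>\<bar>u\<bar>\<rfloor>)) - G (nat \<lfloor>\<bar>u\<bar>\<rfloor>))" for u :: real
  have "norm (A' u) \<le> d" for u
  proof -
    have "norm (A' u) \<le> norm (G (Suc (nat \<lfloor>\<bar>u\<bar>\<rfloor>)) - G (nat \<lfloor>\<bar>u\<bar>\<rfloor>))"
      unfolding A'_def norm_scaleR by (intro mult_left_le_one_le) (auto simp: abs_sgn_eq)
    then show ?thesis using G(2)[of "nat \<lfloor>\<bar>u\<bar>\<rfloor>"] \<delta>(2) by linarith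
  qed
  moreover have "(A has_vector_derivative A' u) (at u)" if "u \<notin> \<int>" for u
    unfolding A_def A'_def by (rule polygonal_abs_has_vector_derivative[OF that])
  moreover have "countable (\<int> :: real set)" by (simp add: Ints_def)
  ultimately have qc: "quasiconformal UNIV (twist A)" "inj (twist A)"
    using d(2)[of A "\<int>" A', OF nd lip] by blast+
  have "point_evaluation e ` infinitesimal_space 0 (twist A) = X"
    unfolding A_def
  proof (rule point_evaluation_infinitesimal_space_twist[OF \<open>c / 2 > 0\<close> nd[unfolded A_def] G(3)])
    show "continuous_on UNIV (twist (\<lambda>u. polygonal G \<bar>u\<bar>))"
      using twist_continuous[OF nd lip] by (simp add: A_def)
    show "inj (twist (\<lambda>u. polygonal G \<bar>u\<bar>))" using qc(2) by (simp add: A_def)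
    show "norm e = 1" by (simp add: e_def)
    show "closed X" by (rule compact_imp_closed[OF X(1)])
    show "normalized_image e (G k) \<in> X" for k by (rule lift_value_mem[OF G(1)])
  qed (rule G(4))
  with qc(1) show ?thesis by blast
qed

end

theorem theorem2p14:
  fixes X :: "(real^'n::finite) set"
    and i1 :: 'n \<comment> \<open>the index of the first coordinate\<close>
  assumes "CARD('n) \<ge> 3"
    and "X \<subseteq> UNIV - {0}"
    and "X \<noteq> {}" and "compact X" and "connected X"
  shows "\<exists>f :: real^'n \<Rightarrow> real^'n. quasiconformal UNIV f \<and>
           point_evaluation (axis i1 1) ` infinitesimal_space 0 f = X"
  by (rule quasiconformal_with_prescribed_evaluation) (use assms in auto)

end
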